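(* Let $a$ and $b$ be positive integers with $b\geqslant2$ and let $N=a+b$. Let $\phi:\mathcal H\to\mathcal U$ be the normalized isomorphism. (1) If $a$ and $b$ are both odd, then $$\phi(\zeta^{\mathfrak m}(a,b))=\sum_{\substack{3\leqslant r\leqslant N-2\\ r\text{ odd}}}\left(\binom{r-1}{b-1}-\binom{r-1}{a-1}\right)f_rf_{N-r}+\mathbf 1_{\{a\geqslant 3\}}\,f_af_b\quad\text{modulo } \mathbb Q f_2^{N/2}.$$ (2) If $a$ and $b$ are both even, then $$\phi(\zeta^{\mathfrak m}(a,b))=\sum_{\substack{3\leqslant r\leqslant N-2\\ r\text{ odd}}}\left(\binom{r-1}{a-1}-\binom{r-1}{b-1}\right)f_rf_{N-r}\quad\text{modulo }\mathbb Q f_2^{N/2}.$$ (3) If $a$ is even and $b$ is odd, then $$\phi(\zeta^{\mathfrak m}(a,b))=\sum_{\substack{3\leqslant r\leqslant N-2\\ r\text{ odd}}}\left(\binom{r-1}{b-1}+\binom{r-1}{a-1}\right)f_rf_{N-r}-\frac12\left(\binom Na+1\right)f_N.$$ (4) If $a$ is odd and $b$ is even, then $$\phi(\zeta^{\mathfrak m}(a,b))=-\sum_{\substack{3\leqslant r\leqslant N-2\\ r\text{ odd}}}\left(\binom{r-1}{b-1}+\binom{r-1}{a-1}\right)f_rf_{N-r}+\mathbf 1_{\{a\geqslant 3\}}\,f_af_b+\frac12\left(\binom Na-1\right)f_N.$$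
   Context: **Motivic multiple zeta values.** $\mathcal H=\bigoplus_{n\geqslant 0}\mathcal H_n$ is Brown's graded $\mathbb Q$-algebra of motivic multiple zeta values; $\mathcal H_n$ is spanned by motivic iterated integrals $I^{\mathfrak m}(\epsilon_0;\epsilon_1\dots\epsilon_n;\epsilon_{n+1})$, $\epsilon_i\in\{0,1\}$, which satisfy: $I^{\mathfrak m}=0$ if $\epsilon_0=\epsilon_{n+1}$ and $n\geqslant1$; $I^{\mathfrak m}(\epsilon_0;\epsilon_1;\epsilon_2)=0$, $I^{\mathfrak m}(\epsilon_0;\epsilon_1)=1$; $I^{\mathfrak m}(0;\epsilon_1\dots\epsilon_n;1)=(-1)^nI^{\mathfrak m}(1;\epsilon_n\dots\epsilon_1;0)=(-1)^nI^{\mathfrak m}(0;(1-\epsilon_n)\dots(1-\epsilon_1);1)$; and the shuffle product formula for fixed endpoints. $\zeta^{\mathfrak m}(n)=-I^{\mathfrak m}(0;1\,0^{n-1};1)$ and $\zeta^{\mathfrak m}(a,b)=I^{\mathfrak m}(0;1\,0^{a-1}\,1\,0^{b-1};1)$ ($0^k$ means $k$ zeros). There is a ring homomorphism $\mathrm{per}:\mathcal H\to\mathbb R$ with $\zeta^{\mathfrak m}(n)\mapsto\zeta(n)$ and $\zeta^{\mathfrak m}(a,b)\mapsto\zeta(a,b)=\sum_{k_2>k_1\geqslant1}k_1^{-a}k_2^{-b}$. Let $\mathcal A=\mathcal H/\zeta^{\mathfrak m}(2)\mathcal H$ and $\mathcal L=\mathcal A_{>0}/(\mathcal A_{>0})^2$;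 $I^{\mathcal L},\zeta^{\mathcal L}$ denote images in $\mathcal L$. For odd $r\geqslant 3$ and $n\geqslant r+2$, $D_r:\mathcal H_n\to\mathcal L_r\otimes\mathcal H_{n-r}$ is (the projection of a graded piece of the motivic coaction) $$D_rI^{\mathfrak m}(\epsilon_0;\epsilon_1\dots \epsilon_n;\epsilon_{n+1})=\sum_{p=0}^{n-r}I^{\mathcal L}(\epsilon_p;\epsilon_{p+1}\dots \epsilon_{p+r};\epsilon_{p+r+1})\otimes I^{\mathfrak m}(\epsilon_0;\epsilon_1\dots \epsilon_{p}\,\epsilon_{p+r+1}\dots \epsilon_n;\epsilon_{n+1}).$$ **The $f$-alphabet.** $\mathcal U'=\mathbb Q\langle f_3,f_5,f_7,\dots\rangle$ is the graded Hopf algebra with basis the words in $f_{2k+1}$ ($k\geqslant1$, degree $2k+1$), shuffle product and deconcatenation coproduct; $\mathcal U=\mathcal U'\otimes\mathbb Q[f_2]$ with $f_2$ of degree 2, commuting with all words. For $n\geqslant1$, $f_{2n}:=b_nf_2^n$ where $b_n\in\mathbb Q$ is defined by $\zeta(2n)=b_n\zeta(2)^n$. $\partial_r$ ($r\ge3$ odd) removes the first letter of a word if it is $f_r$, sends the word to $0$ otherwise, and kills $f_2$; $c_r:\mathcal U_r\to\mathbb Q$ gives the coefficient of $f_r$ (for $r$ odd). The normalized isomorphism $\phi:\mathcal H\to\mathcal U$ is a graded isomorphism of algebra-comodules with $\phi(\zeta^{\mathfrak m}(2))=f_2$ and $\phi(\zeta^{\mathfrak m}(2n+1))=f_{2n+1}$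 for $n\geqslant1$; in particular $\phi^{-1}\partial_r\phi=((c_r\circ\phi)\otimes \mathrm{id})\circ D_r$. *)

theory Defs
  imports "HOL-Analysis.Analysis" "HOL-Library.Multiset" "HOL-Library.Poly_Mapping"
begin

section \<open>Rational vector spaces with a given basis\<close>

definition rsmult :: "rat \<Rightarrow> ('a \<Rightarrow>\<^sub>0 rat) \<Rightarrow> ('a \<Rightarrow>\<^sub>0 rat)" where
  "rsmult c = Poly_Mapping.map ((*) c)"

lemma lookup_rsmult [simp]: "Poly_Mapping.lookup (rsmult c x) k = c * Poly_Mapping.lookup x k"
  by (simp add: rsmult_def Poly_Mapping.map.rep_eq when_def)

interpretation free: vector_space "rsmult :: rat \<Rightarrow> ('a \<Rightarrow>\<^sub>0 rat) \<Rightarrow> ('a \<Rightarrow>\<^sub>0 rat)"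
  by unfold_locales (auto intro!: poly_mapping_eqI simp: lookup_add algebra_simps)

abbreviation basis :: "'a \<Rightarrow> ('a \<Rightarrow>\<^sub>0 rat)" where
  "basis k \<equiv> Poly_Mapping.single k 1"

definition lin_ext :: "('a \<Rightarrow> ('b \<Rightarrow>\<^sub>0 rat)) \<Rightarrow> ('a \<Rightarrow>\<^sub>0 rat) \<Rightarrow> ('b \<Rightarrow>\<^sub>0 rat)" where
  "lin_ext g x = (\<Sum>k\<in>Poly_Mapping.keys x. rsmult (Poly_Mapping.lookup x k) (g k))"

definition bilin_ext ::
  "('a \<Rightarrow> 'b \<Rightarrow> ('c \<Rightarrow>\<^sub>0 rat)) \<Rightarrow> ('a \<Rightarrow>\<^sub>0 rat) \<Rightarrow> ('b \<Rightarrow>\<^sub>0 rat) \<Rightarrow> ('c \<Rightarrow>\<^sub>0 rat)" where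
  "bilin_ext g x y = lin_ext (\<lambda>i. lin_ext (g i) y) x"

section \<open>Shuffles\<close>

text \<open>Shuffles are counted with multiplicity, unlike in the set-valued library function
  \<open>shuffles\<close>.\<close>

fun shuffle_mset :: "'a list \<Rightarrow> 'a list \<Rightarrow> 'a list multiset" where
  "shuffle_mset [] v = {#v#}"
| "shuffle_mset u [] = {#u#}"
| "shuffle_mset (a # u) (b # v) =
     image_mset ((#) a) (shuffle_mset u (b # v)) + image_mset ((#) b) (shuffle_mset (a # u) v)"

section \<open>Real zeta values\<close>

definition zeta_val :: "nat \<Rightarrow> real" where
  "zeta_val n = suminf (\<lambda>k. 1 / real (Suc k) ^ n)"

definition dzeta_val :: "nat \<Rightarrow> nat \<Rightarrow> real" where
  "dzeta_val a b =
     (\<Sum>\<^sub>\<infinity>(k1, k2)\<in>{(k1, k2). 1 \<le> k1 \<and> k1 < k2}. 1 / (real k1 ^ a * real k2 ^ b))"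

text \<open>The rational number \<open>b\<^sub>n\<close> with \<open>\<zeta>(2n) = b\<^sub>n \<zeta>(2)\<^sup>n\<close>; used for \<open>n \<ge> 1\<close> only.\<close>

definition even_zeta_ratio :: "nat \<Rightarrow> rat" where
  "even_zeta_ratio n = (THE q. zeta_val (2 * n) = of_rat q * zeta_val 2 ^ n)"

section \<open>Tensor products over the rationals\<close>

text \<open>For a rational vector space \<open>H\<close> with scalar multiplication \<open>smul\<close> and a subspace \<open>K\<close>,
  the tensor product of \<open>H/K\<close> with \<open>H\<close> is the free vector space on \<open>H \<times> H\<close> modulo
  \<open>tensor_null smul K\<close>; the pure tensor of the class of \<open>x\<close> with \<open>y\<close> is represented by
  \<open>basis (x, y)\<close>.\<close>

definition tensor_null ::
  "(rat \<Rightarrow> 'h \<Rightarrow> 'h) \<Rightarrow> 'h set \<Rightarrow> ('h::ab_group_add \<times> 'h \<Rightarrow>\<^sub>0 rat) set" where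
  "tensor_null smul K = free.span
     (  {basis (x + x', y) - basis (x, y) - basis (x', y) | x x' y. True}
      \<union> {basis (x, y + y') - basis (x, y) - basis (x, y') | x y y'. True}
      \<union> {basis (smul c x, y) - rsmult c (basis (x, y)) | c x y. True}
      \<union> {basis (x, smul c y) - rsmult c (basis (x, y)) | c x y. True}
      \<union> {basis (x, y) | x y. x \<in> K})"

definition tensor_eq ::
  "(rat \<Rightarrow> 'h \<Rightarrow> 'h) \<Rightarrow> 'h set \<Rightarrow> ('h::ab_group_add \<times> 'h \<Rightarrow>\<^sub>0 rat) \<Rightarrow> ('h \<times> 'h \<Rightarrow>\<^sub>0 rat) \<Rightarrow> bool" where
  "tensor_eq smul K t u \<longleftrightarrow> t - u \<in> tensor_null smul K"

definition tensor_mult ::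
  "('h::comm_ring_1 \<times> 'h \<Rightarrow>\<^sub>0 rat) \<Rightarrow> ('h \<times> 'h \<Rightarrow>\<^sub>0 rat) \<Rightarrow> ('h \<times> 'h \<Rightarrow>\<^sub>0 rat)" where
  "tensor_mult = bilin_ext (\<lambda>(x, y) (x', y'). basis (x * x', y * y'))"

definition tensor_map ::
  "('h \<Rightarrow> ('a \<Rightarrow>\<^sub>0 rat)) \<Rightarrow> ('h \<Rightarrow> ('b \<Rightarrow>\<^sub>0 rat)) \<Rightarrow> ('h \<times> 'h \<Rightarrow>\<^sub>0 rat) \<Rightarrow> ('a \<times> 'b \<Rightarrow>\<^sub>0 rat)" where
  "tensor_map f g = lin_ext (\<lambda>(x, y). bilin_ext (\<lambda>i j. basis (i, j)) (f x) (g y))"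

text \<open>The part of a tensor whose left factors have degree \<open>r\<close>, for a representative all of
  whose left factors are homogeneous.\<close>

definition left_degree_part ::
  "(nat \<Rightarrow> 'h set) \<Rightarrow> nat \<Rightarrow> ('h \<times> 'h \<Rightarrow>\<^sub>0 rat) \<Rightarrow> ('h \<times> 'h \<Rightarrow>\<^sub>0 rat)" where
  "left_degree_part gr r t =
     (\<Sum>p | p \<in> Poly_Mapping.keys t \<and> fst p \<in> gr r. rsmult (Poly_Mapping.lookup t p) (basis p))"

section \<open>Motivic multiple zeta values\<close>

text \<open>The letters \<open>0\<close> and \<open>1\<close> of motivic iterated integrals are encoded as \<open>False\<close> and \<open>True\<close>;
  \<open>Imot x w y\<close> stands for \<open>I\<^sup>m(x; w; y)\<close>.\<close>

definition zeta_mot :: "(bool \<Rightarrow> bool list \<Rightarrow> bool \<Rightarrow> 'h::comm_ring_1) \<Rightarrow> nat \<Rightarrow> 'h" where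
  "zeta_mot Imot n = - Imot False (True # replicate (n - 1) False) True"

definition dzeta_mot :: "(bool \<Rightarrow> bool list \<Rightarrow> bool \<Rightarrow> 'h::comm_ring_1) \<Rightarrow> nat \<Rightarrow> nat \<Rightarrow> 'h" where
  "dzeta_mot Imot a b =
     Imot False (True # replicate (a - 1) False @ True # replicate (b - 1) False) True"

text \<open>\<open>\<A> = H / A_kernel\<close>, and \<open>\<L>\<close> is the quotient of the positive degree part of \<open>H\<close>
  by \<open>L_kernel\<close>, that is, by products of elements of positive degree and multiples of
  \<open>\<zeta>\<^sup>m(2)\<close>.\<close>

definition A_kernel :: "(bool \<Rightarrow> bool list \<Rightarrow> bool \<Rightarrow> 'h::comm_ring_1) \<Rightarrow> 'h set" where
  "A_kernel Imot = {zeta_mot Imot 2 * x | x. True}"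

definition positive_part ::
  "(rat \<Rightarrow> 'h \<Rightarrow> 'h) \<Rightarrow> (nat \<Rightarrow> 'h set) \<Rightarrow> 'h::comm_ring_1 set" where
  "positive_part smul gr = module.span smul (\<Union>n\<in>{0<..}. gr n)"

definition L_kernel ::
  "(rat \<Rightarrow> 'h \<Rightarrow> 'h) \<Rightarrow> (nat \<Rightarrow> 'h set) \<Rightarrow> (bool \<Rightarrow> bool list \<Rightarrow> bool \<Rightarrow> 'h::comm_ring_1) \<Rightarrow> 'h set" where
  "L_kernel smul gr Imot = module.span smul
     (A_kernel Imot \<union> {x * y | x y. x \<in> positive_part smul gr \<and> y \<in> positive_part smul gr})"

text \<open>The right-hand side of the formula for \<open>D\<^sub>r\<close>, as a tensor of representatives:
  the list \<open>e0 # w @ [e1]\<close> is \<open>\<epsilon>\<^sub>0, \<dots>, \<epsilon>\<^bsub>n+1\<^esub>\<close>.\<close>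

definition D_formula ::
  "(bool \<Rightarrow> bool list \<Rightarrow> bool \<Rightarrow> 'h) \<Rightarrow> nat \<Rightarrow> bool \<Rightarrow> bool list \<Rightarrow> bool \<Rightarrow> ('h \<times> 'h \<Rightarrow>\<^sub>0 rat)" where
  "D_formula Imot r e0 w e1 =
     (let e = e0 # w @ [e1] in
      \<Sum>p = 0..length w - r.
        basis (Imot (e ! p) (take r (drop p w)) (e ! (p + r + 1)),
               Imot e0 (take p w @ drop (p + r) w) e1))"

text \<open>Brown's algebra \<open>H\<close> enters through the following structure: a graded commutative
  rational algebra (the type \<open>'h\<close>, with graded pieces \<open>gr n\<close>), spanned by symbols \<open>Imot x w y\<close>,
  with a period map and a coaction \<open>coact\<close> from \<open>H\<close> to the tensor product of \<open>\<A>\<close> and \<open>H\<close>.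
  The value \<open>coact x\<close> is a representative in the sense of \<open>tensor_null\<close>, chosen homogeneous
  when \<open>x\<close> is; so identities of tensors hold up to \<open>tensor_eq\<close>.  The operator \<open>D\<^sub>r\<close> is the
  image in \<open>\<L>\<^sub>r \<otimes> H\<close> of the part of \<open>coact\<close> of left degree \<open>r\<close>.
  The counit and coassociativity laws of the coaction are not required.\<close>

locale motivic_mzv = vector_space smul
  for smul :: "rat \<Rightarrow> 'h::comm_ring_1 \<Rightarrow> 'h" +
  fixes gr :: "nat \<Rightarrow> 'h set"
    and Imot :: "bool \<Rightarrow> bool list \<Rightarrow> bool \<Rightarrow> 'h"
    and per :: "'h \<Rightarrow> real"
    and coact :: "'h \<Rightarrow> ('h \<times> 'h \<Rightarrow>\<^sub>0 rat)"
  assumes scale_mult: "smul c x * y = smul c (x * y)"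
    and gr_direct_sum:
      "\<exists>!f. (\<forall>n. f n \<in> gr n) \<and> finite {n. f n \<noteq> 0} \<and> x = (\<Sum>n | f n \<noteq> 0. f n)"
    and gr_one: "1 \<in> gr 0"
    and gr_mult: "x \<in> gr m \<Longrightarrow> y \<in> gr n \<Longrightarrow> x * y \<in> gr (m + n)"
    and gr_span: "gr n = span {Imot e0 w e1 | e0 w e1. length w = n}"
    and Im_equal_endpoints: "w \<noteq> [] \<Longrightarrow> Imot e w e = 0"
    and Im_single: "Imot e0 [e] e1 = 0"
    and Im_empty: "Imot e0 [] e1 = 1"
    and Im_reverse: "Imot False w True = (- 1) ^ length w * Imot True (rev w) False"
    and Im_dual: "Imot False w True = (- 1) ^ length w * Imot False (rev (map Not w)) True"
    and Im_shuffle: "Imot e0 u e1 * Imot e0 v e1 = (\<Sum>w\<in>#shuffle_mset u v. Imot e0 w e1)"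
    and per_add: "per (x + y) = per x + per y"
    and per_mult: "per (x * y) = per x * per y"
    and per_one: "per 1 = 1"
    and per_zeta: "2 \<le> n \<Longrightarrow> per (zeta_mot Imot n) = zeta_val n"
    and per_dzeta: "1 \<le> a \<Longrightarrow> 2 \<le> b \<Longrightarrow> per (dzeta_mot Imot a b) = dzeta_val a b"
    and coact_add: "tensor_eq smul (A_kernel Imot) (coact (x + y)) (coact x + coact y)"
    and coact_scale: "tensor_eq smul (A_kernel Imot) (coact (smul c x)) (rsmult c (coact x))"
    and coact_mult:
      "tensor_eq smul (A_kernel Imot) (coact (x * y)) (tensor_mult (coact x) (coact y))"
    and coact_one: "tensor_eq smul (A_kernel Imot) (coact 1) (basis (1, 1))"
    and coact_graded:
      "x \<in> gr n \<Longrightarrow> Poly_Mapping.keys (coact x) \<subseteq> (\<Union>i\<le>n. gr i \<times> gr (n - i))"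
    and D_Im:
      "odd r \<Longrightarrow> 3 \<le> r \<Longrightarrow> r + 2 \<le> length w \<Longrightarrow>
       tensor_eq smul (L_kernel smul gr Imot)
         (left_degree_part gr r (coact (Imot e0 w e1))) (D_formula Imot r e0 w e1)"

section \<open>The f-alphabet\<close>

text \<open>The pair \<open>(w, k)\<close> stands for the basis element \<open>w f\<^sub>2\<^sup>k\<close> of \<open>\<U>\<close>, where the letter
  \<open>f\<^sub>r\<close> of the word \<open>w\<close> is encoded as the number \<open>r\<close>.\<close>

type_synonym fpoly = "nat list \<times> nat \<Rightarrow>\<^sub>0 rat"

definition f_words :: "nat list set" where
  "f_words = {w. \<forall>r\<in>set w. odd r \<and> 3 \<le> r}"

definition U :: "fpoly set" where
  "U = {x. Poly_Mapping.keys x \<subseteq> f_words \<times> UNIV}"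

definition U_gr :: "nat \<Rightarrow> fpoly set" where
  "U_gr n = {x \<in> U. \<forall>(w, k)\<in>Poly_Mapping.keys x. sum_list w + 2 * k = n}"

definition U_mult :: "fpoly \<Rightarrow> fpoly \<Rightarrow> fpoly" where
  "U_mult = bilin_ext (\<lambda>(u, i) (v, j). \<Sum>w\<in>#shuffle_mset u v. basis (w, i + j))"

text \<open>Juxtaposition, as in \<open>f\<^sub>r f\<^sub>s\<close>, means concatenation of words (not the product
  \<open>U_mult\<close>), extended by the powers of \<open>f\<^sub>2\<close>.\<close>

definition f_conc :: "fpoly \<Rightarrow> fpoly \<Rightarrow> fpoly" where
  "f_conc = bilin_ext (\<lambda>(u, i) (v, j). basis (u @ v, i + j))"

definition f2_power :: "nat \<Rightarrow> fpoly" where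
  "f2_power k = basis ([], k)"

definition f_gen :: "nat \<Rightarrow> fpoly" where
  "f_gen n = (if odd n then basis ([n], 0)
              else rsmult (even_zeta_ratio (n div 2)) (f2_power (n div 2)))"

text \<open>The projection from \<open>\<U>\<close> to \<open>\<U>' = \<U>/f\<^sub>2\<U>\<close> and the coaction of \<open>\<U>'\<close> on \<open>\<U>\<close>.\<close>

definition mod_f2 :: "fpoly \<Rightarrow> (nat list \<Rightarrow>\<^sub>0 rat)" where
  "mod_f2 = lin_ext (\<lambda>(w, k). if k = 0 then basis w else 0)"

definition deconcatenate :: "fpoly \<Rightarrow> (nat list \<times> (nat list \<times> nat) \<Rightarrow>\<^sub>0 rat)" where
  "deconcatenate = lin_ext (\<lambda>(w, k). \<Sum>i\<le>length w. basis (take i w, (drop i w, k)))"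

text \<open>In \<open>iso_coact\<close> the left factor is the isomorphism from \<open>\<A> = H/\<zeta>\<^sup>m(2)H\<close> to \<open>\<U>'\<close> induced
  by \<open>\<phi>\<close>.\<close>

locale normalized_iso =
  fixes smul :: "rat \<Rightarrow> 'h::comm_ring_1 \<Rightarrow> 'h"
    and gr :: "nat \<Rightarrow> 'h set"
    and Imot :: "bool \<Rightarrow> bool list \<Rightarrow> bool \<Rightarrow> 'h"
    and coact :: "'h \<Rightarrow> ('h \<times> 'h \<Rightarrow>\<^sub>0 rat)"
    and \<phi> :: "'h \<Rightarrow> fpoly"
  assumes iso_bij: "bij_betw \<phi> UNIV U"
    and iso_add: "\<phi> (x + y) = \<phi> x + \<phi> y"
    and iso_scale: "\<phi> (smul c x) = rsmult c (\<phi> x)"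
    and iso_one: "\<phi> 1 = basis ([], 0)"
    and iso_mult: "\<phi> (x * y) = U_mult (\<phi> x) (\<phi> y)"
    and iso_graded: "\<phi> ` gr n = U_gr n"
    and iso_coact: "tensor_map (mod_f2 \<circ> \<phi>) \<phi> (coact x) = deconcatenate (\<phi> x)"
    and iso_zeta2: "\<phi> (zeta_mot Imot 2) = f2_power 1"
    and iso_zeta_odd: "1 \<le> n \<Longrightarrow> \<phi> (zeta_mot Imot (2 * n + 1)) = f_gen (2 * n + 1)"

end

theory Submission
  imports Defs "HOL-Computational_Algebra.Polynomial"
begin

text \<open>The coaction formula gives all derivatives \<open>\<partial>\<^sub>r \<phi>(\<zeta>\<^sup>m(a, b))\<close> with \<open>r \<le> N - 2\<close>: only
  three subwords, each containing a single 1, contribute modulo products, and their right factors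
  are all \<open>\<zeta>\<^sup>m(N - r)\<close>. This determines \<open>\<phi>(\<zeta>\<^sup>m(a, b))\<close> up to a multiple of
  \<open>f\<^sub>2\<^bsup>N/2\<^esup>\<close> or \<open>f\<^sub>N\<close>. For odd \<open>N\<close> the period map turns the remaining coefficient into
  that of \<open>\<zeta>(N)\<close> in Euler's evaluation of \<open>\<zeta>(a, b)\<close>, obtained by solving the double shuffle
  relations for the generating polynomial.\<close>

section \<open>Stuffle and sum formula for real double zeta values\<close>

text \<open>The letter f_N is invisible to the derivatives with r \<le> N - 2, so only
  \<open>per\<close> can find its coefficient. For odd N and odd r, the number N - r is even and
  f_{N-r} is a rational multiple of a power of f_2. Every f_r f_{N-r} is then a genuine product, the
  image of zeta(r) zeta(N-r), and the formula for \<open>\<phi>\<close> lifts to an identity in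
  \<open>'h\<close> with one unknown rational coefficient. After \<open>per\<close> all products
  cancel against Euler's evaluation, and zeta(N) > 0 yields the unknown. For even N both letters of
  f_r f_{N-r} are odd, the word is not a product, and the multiple of f_2^{N/2} stays unspecified.

  Euler's evaluation draws on two sources: the shuffle product is an axiom for \<open>Imot\<close>
  and is transferred by \<open>per\<close>, while the stuffle product is proved for the real series.
  The obstacle is zeta(N-1, 1), which occurs formally in the relations but diverges.\<close>

lemma has_sum_zeta_val:
  assumes "2 \<le> n"
  shows "((\<lambda>k. 1 / real (Suc k) ^ n) has_sum zeta_val n) UNIV"
proof -
  have "summable (\<lambda>k. inverse (real k ^ n))"
    by (rule inverse_power_summable[OF assms])
  then have "summable (\<lambda>k. 1 / real (Suc k) ^ n)"
    by (subst (asm) summable_Suc_iff[symmetric]) (simp add: field_simps)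
  then have "(\<lambda>k. 1 / real (Suc k) ^ n) sums zeta_val n"
    unfolding zeta_val_def by (rule summable_sums)
  then show ?thesis
    by (rule sums_nonneg_imp_has_sum) simp
qed

lemma zeta_val_pos:
  assumes "2 \<le> n"
  shows "0 < zeta_val n"
proof -
  have "sum (\<lambda>k. 1 / real (Suc k) ^ n) {0} \<le> zeta_val n"
    by (rule finite_sum_le_has_sum[OF has_sum_zeta_val[OF assms]]) auto
  then show ?thesis by simp
qed

text \<open>The square of the convergent series with terms k^(-3/2) serves as common majorant for
  the double series below.\<close>

lemma summable_on_three_halves_pairs:
  "(\<lambda>(i, j). 1 / (real (Suc i) * real (Suc j) * sqrt (real (Suc i) * real (Suc j))))
     summable_on (UNIV :: (nat \<times> nat) set)"
proof -
  define h where "h k = 1 / (real (Suc k) * sqrt (real (Suc k)))" for k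
  have h_powr: "h k = real (Suc k) powr (- 3 / 2)" for k
  proof -
    have "real (Suc k) powr (1 + 1 / 2) = real (Suc k) * sqrt (real (Suc k))"
      by (subst powr_add) (simp add: powr_half_sqrt)
    then show ?thesis
      by (simp add: h_def powr_minus_divide)
  qed
  have "summable (\<lambda>k. real k powr (- 3 / 2))"
    by (subst summable_real_powr_iff) simp
  then have "summable h"
    unfolding h_powr by (subst summable_Suc_iff)
  then have h: "(h has_sum suminf h) UNIV"
    by (intro sums_nonneg_imp_has_sum summable_sums) (auto simp: h_def)
  have "(\<lambda>p. h (fst p) * h (snd p)) summable_on Sigma UNIV (\<lambda>_. UNIV)"
  proof (rule summable_on_SigmaI)
    show "((\<lambda>y. h (fst (x, y)) * h (snd (x, y))) has_sum h x * suminf h) UNIV" for x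
      using has_sum_cmult_right[OF h] by simp
    show "(\<lambda>x. h x * suminf h) summable_on UNIV"
      using h by (intro summable_on_cmult_left) (auto simp: summable_on_def)
  qed (simp add: h_def)
  then show ?thesis
    by (simp add: h_def case_prod_unfold real_sqrt_mult field_simps del: of_nat_Suc)
qed

lemma sqrt_mult_le_add:
  fixes x y :: real
  assumes "0 \<le> x" "0 \<le> y"
  shows "sqrt (x * y) \<le> x + y"
  using assms by (intro real_le_lsqrt) (auto simp: power2_eq_square algebra_simps)

text \<open>By \<open>\<surd>(x y) \<le> x + y\<close> every term is at most \<open>(x y)\<^sup>-\<^sup>3\<^sup>/\<^sup>2\<close>, where \<open>x\<close>, \<open>y\<close>
  are the two summation variables.\<close>

lemma summable_on_tornheim:
  assumes le: "\<And>i j. f (i, j) \<le> 1 / (real (Suc i) * real (Suc j) * real (i + j + 2))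
      \<or> f (i, j) \<le> 1 / (real (Suc i) * real (i + j + 2) ^ 2)
      \<or> f (i, j) \<le> 1 / (real (Suc j) * real (i + j + 2) ^ 2)"
    and nonneg: "\<And>i j. 0 \<le> f (i, j)"
  shows "f summable_on (UNIV :: (nat \<times> nat) set)"
proof (rule summable_on_comparison_test[OF summable_on_three_halves_pairs])
  fix p :: "nat \<times> nat"
  obtain i j where p: "p = (i, j)" by force
  define x y where "x = real (Suc i)" and "y = real (Suc j)"
  have xy: "0 < x" "0 < y" and m: "real (i + j + 2) = x + y" by (auto simp: x_def y_def)
  have sq: "sqrt (x * y) \<le> x + y" using xy by (intro sqrt_mult_le_add) auto
  have b: "x * y * sqrt (x * y) \<le> x * y * (x + y)"
    using xy sq by (intro mult_left_mono) auto
  have b1: "x * y * sqrt (x * y) \<le> x * (x + y)\<^sup>2"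
    using xy by (intro order_trans[OF b]) (simp add: power2_eq_square algebra_simps)
  have b2: "x * y * sqrt (x * y) \<le> y * (x + y)\<^sup>2"
    using xy by (intro order_trans[OF b]) (simp add: power2_eq_square algebra_simps)
  have "1 / (x * y * (x + y)) \<le> 1 / (x * y * sqrt (x * y))"
      "1 / (x * (x + y)\<^sup>2) \<le> 1 / (x * y * sqrt (x * y))"
      "1 / (y * (x + y)\<^sup>2) \<le> 1 / (x * y * sqrt (x * y))"
    using xy by (intro divide_left_mono[OF b] divide_left_mono[OF b1] divide_left_mono[OF b2]
        mult_pos_pos; simp)+
  then show "f p \<le> (case p of (i, j) \<Rightarrow>
      1 / (real (Suc i) * real (Suc j) * sqrt (real (Suc i) * real (Suc j))))"
    using le[of i j] unfolding m p prod.case x_def[symmetric] y_def[symmetric]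
    by (meson order_trans)
qed (use nonneg in auto)

text \<open>With k1 = \<open>Suc i\<close> and k2 = \<open>i + j + 2\<close> the region k1 < k2
  becomes the full quadrant. There k2 is the sum of \<open>Suc i\<close> and \<open>Suc j\<close>,
  which suits both the comparison test and the partial fractions of the sum formula.\<close>

lemma has_sum_dzeta_val_shift:
  assumes "1 \<le> a" "2 \<le> b"
  shows "((\<lambda>(i, j). 1 / (real (Suc i) ^ a * real (i + j + 2) ^ b)) has_sum dzeta_val a b) UNIV"
proof -
  let ?f = "\<lambda>(i, j). 1 / (real (Suc i) ^ a * real (i + j + 2) ^ b)"
  have "1 / (real (Suc i) ^ a * real (i + j + 2) ^ b) \<le> 1 / (real (Suc i) * real (i + j + 2) ^ 2)" for i j
  proof -
    have "real (Suc i) ^ 1 \<le> real (Suc i) ^ a"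
      by (rule power_increasing) (use assms in auto)
    moreover have "real (i + j + 2) ^ 2 \<le> real (i + j + 2) ^ b"
      by (rule power_increasing) (use assms in auto)
    ultimately have "real (Suc i) * real (i + j + 2) ^ 2 \<le> real (Suc i) ^ a * real (i + j + 2) ^ b"
      by (intro mult_mono) auto
    then show ?thesis
      by (intro divide_left_mono) auto
  qed
  then have "?f summable_on UNIV"
    by (intro summable_on_tornheim) (simp_all only: prod.case, auto)
  moreover have "infsum ?f UNIV = dzeta_val a b"
  proof -
    have "bij_betw (\<lambda>(i, j). (Suc i, i + j + 2)) UNIV {(k, l). 1 \<le> k \<and> k < (l :: nat)}"
      by (rule bij_betwI[of _ _ _ "\<lambda>(k, l). (k - 1, l - k - 1)"]) auto
    from infsum_reindex_bij_betw[OF this, of "\<lambda>(k, l). 1 / (real k ^ a * real l ^ b)"]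
    show ?thesis
      by (simp only: dzeta_val_def case_prod_unfold fst_conv snd_conv)
  qed
  ultimately show ?thesis
    using has_sum_infsum[of ?f UNIV] by simp
qed

lemma has_sum_dzeta_val:
  assumes "1 \<le> a" "2 \<le> b"
  shows "((\<lambda>(i, j). 1 / (real (Suc i) ^ a * real (Suc j) ^ b)) has_sum dzeta_val a b) {(i, j). i < j}"
proof -
  have "bij_betw (\<lambda>(i, j). (i, Suc (i + j))) UNIV {(i, j). i < j}"
    by (rule bij_betwI[of _ _ _ "\<lambda>(i, j). (i, j - i - 1)"]) auto
  from has_sum_reindex_bij_betw[OF this, of "\<lambda>(i, j). 1 / (real (Suc i) ^ a * real (Suc j) ^ b)"]
  show ?thesis
    using has_sum_dzeta_val_shift[OF assms] by (simp add: case_prod_unfold add_ac)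
qed

text \<open>The product is a sum over the quadrant, which is cut into two open triangles and the
  diagonal.\<close>

lemma stuffle_dzeta_val:
  assumes "2 \<le> a" "2 \<le> b"
  shows "zeta_val a * zeta_val b = dzeta_val a b + dzeta_val b a + zeta_val (a + b)"
proof -
  let ?f = "\<lambda>(i, j). 1 / (real (Suc i) ^ a * real (Suc j) ^ b)"
  note za = has_sum_zeta_val[OF assms(1)] and zb = has_sum_zeta_val[OF assms(2)]
  have inner: "((\<lambda>j. ?f (i, j)) has_sum 1 / real (Suc i) ^ a * zeta_val b) UNIV" for i
    using has_sum_cmult_right[OF zb, of "1 / real (Suc i) ^ a"] by simp
  have outer: "((\<lambda>i. 1 / real (Suc i) ^ a * zeta_val b) has_sum zeta_val a * zeta_val b) UNIV"
    by (rule has_sum_cmult_left[OF za])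
  have "?f summable_on Sigma UNIV (\<lambda>_. UNIV)"
    by (rule summable_on_SigmaI[OF inner]) (use outer in \<open>auto simp: summable_on_def\<close>)
  from has_sum_SigmaI[OF inner outer this]
  have prod: "(?f has_sum zeta_val a * zeta_val b) UNIV" by simp
  have lt: "(?f has_sum dzeta_val a b) {(i, j). i < j}"
    using assms by (intro has_sum_dzeta_val) auto
  have "bij_betw prod.swap {(i, j). j < i} {(i, j). i < (j :: nat)}"
    by (rule bij_betwI[of _ _ _ prod.swap]) auto
  from has_sum_reindex_bij_betw[OF this, of "\<lambda>(i, j). 1 / (real (Suc i) ^ b * real (Suc j) ^ a)"]
  have gt: "(?f has_sum dzeta_val b a) {(i, j). j < i}"
    using has_sum_dzeta_val[of b a] assms by (simp add: case_prod_unfold mult.commute)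
  have "bij_betw (\<lambda>i. (i, i)) UNIV {(i, j). i = (j :: nat)}"
    by (rule bij_betwI[of _ _ _ fst]) auto
  from has_sum_reindex_bij_betw[OF this, of ?f]
  have eq: "(?f has_sum zeta_val (a + b)) {(i, j). i = j}"
    using has_sum_zeta_val[of "a + b"] assms by (simp add: power_add)
  have "(?f has_sum dzeta_val a b + dzeta_val b a + zeta_val (a + b))
      ({(i, j). i < j} \<union> {(i, j). j < i} \<union> {(i, j). i = j})"
    by (intro has_sum_Un_disjoint lt gt eq) auto
  also have "{(i, j). i < j} \<union> {(i, j). j < i} \<union> {(i, j). i = (j :: nat)} = UNIV"
    by auto
  finally show ?thesis
    by (rule has_sum_unique[OF prod])
qed

lemma has_sum_sum:
  fixes f :: "'i \<Rightarrow> 'a \<Rightarrow> 'b::topological_comm_monoid_add"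
  assumes "\<And>i. i \<in> I \<Longrightarrow> (f i has_sum S i) A"
  shows "((\<lambda>x. \<Sum>i\<in>I. f i x) has_sum (\<Sum>i\<in>I. S i)) A"
  using assms by (induction I rule: infinite_finite_induct) (auto intro: has_sum_add)

text \<open>Induction on \<open>n\<close>: the increment 1/(j+n+1) - 1/(j+n+2) telescopes in j to
  1/(n+1).\<close>

lemma sums_harmonic_difference:
  "(\<lambda>j. 1 / real (Suc j) - 1 / real (j + n + 1)) sums (\<Sum>i<n. 1 / real (Suc i))"
proof (induction n)
  case (Suc n)
  have "(\<lambda>j. 1 / real (j + n + 1)) \<longlonglongrightarrow> 0"
    using LIMSEQ_ignore_initial_segment[OF lim_1_over_n, of "n + 1"] by (simp only: add.assoc)
  from telescope_sums'[OF this]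
  have "(\<lambda>j. 1 / real (j + n + 1) - 1 / real (Suc j + n + 1)) sums (1 / real (Suc n))"
    by (simp only: add_0 diff_zero Suc_eq_plus1)
  from sums_add[OF Suc.IH this] show ?case
    by (simp add: algebra_simps)
qed simp

text \<open>Summing the geometric progression over the exponents leaves
  \<open>1 / (j n\<^sup>d (n + j)) - 1 / (j (n + j)\<^sup>d\<^sup>+\<^sup>1)\<close>; the first part is summed over \<open>j\<close> by
  telescoping.\<close>

lemma sum_formula_dzeta_val:
  assumes "1 \<le> d"
  shows "(\<Sum>i<d. dzeta_val (Suc i) (d + 1 - i)) = zeta_val (d + 2)"
proof -
  define A where "A = (\<lambda>(i, j). 1 / (real (Suc j) * real (Suc i) ^ d * real (i + j + 2)))"
  define B where "B = (\<lambda>(i, j). 1 / (real (Suc j) * real (i + j + 2) ^ (d + 1)))"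
  have pow: "real (Suc i) \<le> real (Suc i) ^ d" for i
    using power_increasing[of 1 d "real (Suc i)"] assms by simp
  have "A summable_on UNIV"
  proof (rule summable_on_tornheim)
    fix i j
    have "real (Suc i) * real (Suc j) * real (i + j + 2) \<le> real (Suc j) * real (Suc i) ^ d * real (i + j + 2)"
      using mult_left_mono[OF pow[of i], of "real (Suc j)"]
      by (intro mult_right_mono) (simp_all add: mult.commute)
    then have "A (i, j) \<le> 1 / (real (Suc i) * real (Suc j) * real (i + j + 2))"
      unfolding A_def prod.case by (intro divide_left_mono) auto
    then show "A (i, j) \<le> 1 / (real (Suc i) * real (Suc j) * real (i + j + 2))
      \<or> A (i, j) \<le> 1 / (real (Suc i) * real (i + j + 2) ^ 2)
      \<or> A (i, j) \<le> 1 / (real (Suc j) * real (i + j + 2) ^ 2)" ..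
  qed (auto simp: A_def)
  have B: "(B has_sum dzeta_val 1 (d + 1)) UNIV"
  proof -
    have "bij_betw prod.swap UNIV (UNIV :: (nat \<times> nat) set)"
      by (rule bij_betwI[of _ _ _ prod.swap]) auto
    from has_sum_reindex_bij_betw[OF this, of B]
    show ?thesis
      using has_sum_dzeta_val_shift[of 1 "d + 1"] assms
      by (simp add: B_def case_prod_unfold add_ac)
  qed
  have inner: "((\<lambda>j. A (i, j)) has_sum (\<Sum>l\<le>i. 1 / real (Suc l)) / real (Suc i) ^ (d + 1)) UNIV" for i
  proof -
    have "A (i, j) = 1 / real (Suc i) ^ (d + 1) * (1 / real (Suc j) - 1 / real (j + Suc i + 1))" for j
    proof -
      define x y where "x = real (Suc i)" and "y = real (Suc j)"
      have xy: "0 < x" "0 < y" and m: "real (i + j + 2) = x + y" "real (j + Suc i + 1) = x + y"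
        by (auto simp: x_def y_def)
      have "1 / (y * x ^ d * (x + y)) = 1 / x ^ (d + 1) * (1 / y - 1 / (x + y))"
        using xy by (simp add: divide_simps)
      then show ?thesis
        unfolding A_def prod.case m x_def[symmetric] y_def[symmetric] .
    qed
    moreover have "(\<lambda>j. 1 / real (Suc i) ^ (d + 1) * (1 / real (Suc j) - 1 / real (j + Suc i + 1)))
        sums (1 / real (Suc i) ^ (d + 1) * (\<Sum>l<Suc i. 1 / real (Suc l)))"
      by (intro sums_mult sums_harmonic_difference)
    ultimately have "(\<lambda>j. A (i, j)) sums ((\<Sum>l\<le>i. 1 / real (Suc l)) / real (Suc i) ^ (d + 1))"
      by (simp add: lessThan_Suc_atMost)
    then show ?thesis
      by (rule sums_nonneg_imp_has_sum) (simp add: A_def)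
  qed
  \<comment> \<open>The inner sums are harmonic numbers; their terms with l < i give zeta(1, d+1),
    and the term l = i gives zeta(d+2).\<close>
  have "((\<lambda>i. (\<Sum>l\<le>i. 1 / real (Suc l)) / real (Suc i) ^ (d + 1))
      has_sum dzeta_val 1 (d + 1) + zeta_val (d + 2)) UNIV"
  proof -
    let ?g = "\<lambda>(l, i). 1 / (real (Suc l) ^ 1 * real (Suc i) ^ (d + 1))"
    have "bij_betw (\<lambda>i. (i, i)) UNIV {(l, i). l = (i :: nat)}"
      by (rule bij_betwI[of _ _ _ fst]) auto
    from has_sum_reindex_bij_betw[OF this, of ?g]
    have "(?g has_sum zeta_val (d + 2)) {(l, i). l = i}"
      using has_sum_zeta_val[of "d + 2"] by (simp add: power_add)
    moreover have "(?g has_sum dzeta_val 1 (d + 1)) {(l, i). l < i}"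
      using assms by (intro has_sum_dzeta_val) auto
    ultimately have g: "(?g has_sum dzeta_val 1 (d + 1) + zeta_val (d + 2)) ({(l, i). l < i} \<union> {(l, i). l = i})"
      by (intro has_sum_Un_disjoint) auto
    have "bij_betw prod.swap (Sigma UNIV (\<lambda>i. {..i})) ({(l, i). l < i} \<union> {(l, i). l = (i :: nat)})"
      by (rule bij_betwI[of _ _ _ prod.swap]) auto
    from has_sum_reindex_bij_betw[OF this, of ?g] g
    have "((\<lambda>p. ?g (prod.swap p)) has_sum dzeta_val 1 (d + 1) + zeta_val (d + 2)) (Sigma UNIV (\<lambda>i. {..i}))"
      by simp
    then show ?thesis
      by (rule has_sum_SigmaD) (auto intro!: has_sum_finiteI simp: sum_divide_distrib)
  qed
  from has_sum_SigmaI[OF inner this]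
  have A: "(A has_sum dzeta_val 1 (d + 1) + zeta_val (d + 2)) UNIV"
    using \<open>A summable_on UNIV\<close> by simp
  have geo: "(\<Sum>l<d. 1 / (real (Suc i) ^ Suc l * real (i + j + 2) ^ (d + 1 - l))) = A (i, j) - B (i, j)" for i j
  proof -
    define x y where "x = real (Suc i)" and "y = real (Suc j)"
    have xy: "0 < x" "0 < y" and m: "real (i + j + 2) = x + y"
      by (auto simp: x_def y_def)
    have "(\<Sum>l<d. 1 / (x ^ Suc l * (x + y) ^ (d + 1 - l))) = 1 / (y * x ^ d * (x + y)) - 1 / (y * (x + y) ^ (d + 1))"
    proof (induction d)
      case (Suc d)
      have "(\<Sum>l<Suc d. 1 / (x ^ Suc l * (x + y) ^ (Suc d + 1 - l)))
          = (\<Sum>l<d. 1 / (x ^ Suc l * (x + y) ^ (d + 1 - l)) / (x + y)) + 1 / (x ^ Suc d * (x + y) ^ 2)"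
        by (simp add: Suc_diff_le power2_eq_square divide_divide_eq_left mult_ac)
      also have "\<dots> = (1 / (y * x ^ d * (x + y)) - 1 / (y * (x + y) ^ (d + 1))) / (x + y) + 1 / (x ^ Suc d * (x + y) ^ 2)"
        by (simp only: sum_divide_distrib[symmetric] Suc)
      also have "\<dots> = 1 / (y * x ^ Suc d * (x + y)) - 1 / (y * (x + y) ^ (Suc d + 1))"
      proof -
        have "x + y \<noteq> 0" using xy by simp
        then show ?thesis
          using xy by (simp add: divide_simps power2_eq_square) (simp add: algebra_simps)
      qed
      finally show ?case .
    qed (use xy in \<open>simp add: divide_simps\<close>)
    then show ?thesis
      unfolding A_def B_def prod.case m x_def[symmetric] y_def[symmetric] .
  qed
  have "((\<lambda>p. \<Sum>l<d. case p of (i, j) \<Rightarrow> 1 / (real (Suc i) ^ Suc l * real (i + j + 2) ^ (d + 1 - l)))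
      has_sum (\<Sum>l<d. dzeta_val (Suc l) (d + 1 - l))) UNIV"
    by (intro has_sum_sum has_sum_dzeta_val_shift) auto
  \<comment> \<open>\<open>A\<close> has now been summed in two ways; both results contain
    \<open>dzeta_val 1 (d + 1)\<close>, which cancels.\<close>
  from has_sum_add[OF this B]
  have "(A has_sum (\<Sum>l<d. dzeta_val (Suc l) (d + 1 - l)) + dzeta_val 1 (d + 1)) UNIV"
    by (rule has_sum_cong[THEN iffD1, rotated]) (simp only: split_paired_all prod.case geo diff_add_cancel)
  from has_sum_unique[OF this A] show ?thesis by simp
qed

section \<open>Solving the double shuffle relations in odd weight\<close>

text \<open>The substitutions \<open>(x, y) \<mapsto> (y, x)\<close> and \<open>(x, y) \<mapsto> (x, x - y)\<close> generate a
  dihedral group of order 12 whose rotation by a half turn is \<open>-1\<close>; alternating the two equations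
  six times therefore relates \<open>f x y\<close> to \<open>f (- x) (- y)\<close>.\<close>

lemma odd_double_shuffle_solution:
  fixes f P S :: "'r::comm_ring_1 \<Rightarrow> 'r \<Rightarrow> 'r"
  assumes stuffle: "\<And>x y. f x y + f y x = P x y - S x y"
    and shuffle: "\<And>x y. f (x + y) y + f (x + y) x = P x y"
    and odd: "\<And>x y. f (- x) (- y) = - f x y"
  shows "2 * f x y = (P x y - P (- x) y) + (P (y - x) (- x) - P (y - x) x)
      + (P y (y - x) - P (- y) (y - x)) - (S x y + S y (y - x) + S (y - x) (- x))"
proof -
  \<comment> \<open>The six brackets are alternately left sides of \<open>stuffle\<close> and
    \<open>shuffle\<close>; with their signs they telescope to
    \<open>f x y - f (- x) (- y)\<close>.\<close>
  have "2 * f x y = (f x y + f y x) - (f ((y - x) + x) x + f ((y - x) + x) (y - x))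
      + (f y (y - x) + f (y - x) y) - (f (- x + y) y + f (- x + y) (- x))
      + (f (y - x) (- x) + f (- x) (y - x)) - (f (- y + (y - x)) (y - x) + f (- y + (y - x)) (- y))"
    by (simp add: odd)
  then show ?thesis
    unfolding stuffle shuffle by (simp add: algebra_simps)
qed

text \<open>Here \<open>d\<close> is the weight minus 2, \<open>z i\<close> stands for zeta(i+1,
  d-i+1), \<open>p m\<close> for zeta(m+1) zeta(d-m+1) and \<open>\<zeta>\<close> for zeta(d+2).
  Keeping them abstract leaves room for regularized values at the divergent ends.\<close>

context
  fixes d :: nat and z p :: "nat \<Rightarrow> real" and \<zeta> :: real
  assumes odd_d: "odd d"
    and stuffle: "\<And>i. i \<le> d \<Longrightarrow> z i + z (d - i) + \<zeta> = p i"
    and shuffle: "\<And>m. m \<le> d \<Longrightarrow>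
      p m = (\<Sum>i\<le>d. (real ((d - i) choose m) + real ((d - i) choose (d - m))) * z i)"
begin

text \<open>The arguments are themselves polynomials, so that the linear substitutions of the
  dihedral argument can be carried out in the ring \<open>real poly\<close> and coefficients
  compared afterwards.\<close>

definition gen_z :: "real poly \<Rightarrow> real poly \<Rightarrow> real poly" where
  "gen_z x y = (\<Sum>i\<le>d. [:z i:] * (x ^ (d - i) * y ^ i))"

definition gen_p :: "real poly \<Rightarrow> real poly \<Rightarrow> real poly" where
  "gen_p x y = (\<Sum>m\<le>d. [:p m:] * (x ^ (d - m) * y ^ m))"

text \<open>This is (x^(d+1) - y^(d+1)) / (x - y), the form in which its coefficients are later
  computed.\<close>

definition gen_1 :: "real poly \<Rightarrow> real poly \<Rightarrow> real poly" where
  "gen_1 x y = (\<Sum>i\<le>d. x ^ i * y ^ (d - i))"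

lemma sum_atMost_flip: "(\<Sum>i\<le>d. g (d - i)) = (\<Sum>i\<le>d. g i)"
  for g :: "nat \<Rightarrow> 'b::comm_monoid_add"
  by (rule sum.reindex_bij_witness[of _ "\<lambda>i. d - i" "\<lambda>i. d - i"]) auto

text \<open>The left side of the stuffle relation is invariant under i \<mapsto> d - i, hence so is
  \<open>p\<close>.\<close>

lemma gen_p_flip: "gen_p x y = (\<Sum>m\<le>d. [:p m:] * (y ^ (d - m) * x ^ m))"
proof -
  have sym: "p (d - m) = p m" if "m \<le> d" for m
    using stuffle[of m] stuffle[of "d - m"] that by simp
  have "gen_p x y = (\<Sum>m\<le>d. [:p (d - m):] * (x ^ (d - (d - m)) * y ^ (d - m)))"
    unfolding gen_p_def by (rule sum_atMost_flip[symmetric])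
  also have "\<dots> = (\<Sum>m\<le>d. [:p m:] * (y ^ (d - m) * x ^ m))"
    by (rule sum.cong) (auto simp: sym mult_ac)
  finally show ?thesis .
qed

lemma gen_stuffle: "gen_z x y + gen_z y x = gen_p x y - [:\<zeta>:] * gen_1 x y"
proof -
  have "gen_z y x = (\<Sum>i\<le>d. [:z (d - i):] * (y ^ (d - (d - i)) * x ^ (d - i)))"
    unfolding gen_z_def by (rule sum_atMost_flip[symmetric])
  moreover have "gen_1 x y = (\<Sum>i\<le>d. x ^ (d - i) * y ^ (d - (d - i)))"
    unfolding gen_1_def by (rule sum_atMost_flip[symmetric])
  ultimately have "gen_z x y + gen_z y x + [:\<zeta>:] * gen_1 x y
      = (\<Sum>i\<le>d. [:z i:] * (x ^ (d - i) * y ^ i) + [:z (d - i):] * (y ^ (d - (d - i)) * x ^ (d - i))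
          + [:\<zeta>:] * (x ^ (d - i) * y ^ (d - (d - i))))"
    by (simp only: gen_z_def sum.distrib sum_distrib_left)
  also have "\<dots> = gen_p x y"
    unfolding gen_p_def
  proof (rule sum.cong)
    fix i assume "i \<in> {..d}"
    then have "i \<le> d" by simp
    then have "[:p i:] = [:z i:] + [:z (d - i):] + [:\<zeta>:]"
      by (simp add: stuffle)
    then show "[:z i:] * (x ^ (d - i) * y ^ i) + [:z (d - i):] * (y ^ (d - (d - i)) * x ^ (d - i))
          + [:\<zeta>:] * (x ^ (d - i) * y ^ (d - (d - i))) = [:p i:] * (x ^ (d - i) * y ^ i)"
      using \<open>i \<le> d\<close>
      by (simp only: diff_diff_cancel distrib_right mult.commute[of "y ^ i"])
  qed simp
  finally show ?thesis by (simp add: algebra_simps)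
qed

text \<open>Expanding the powers of x + y binomially, the coefficient of y^(d-m) x^m is the right
  side of the shuffle relation for \<open>p m\<close>; \<open>gen_p_flip\<close> supplies the
  matching order of the variables.\<close>

lemma gen_shuffle: "gen_z (x + y) y + gen_z (x + y) x = gen_p x y"
proof -
  have expand: "(u + v) ^ (d - i) * v ^ i = (\<Sum>m\<le>d. of_nat ((d - i) choose m) * (v ^ (d - m) * u ^ m))"
    if "i \<le> d" for u v :: "real poly" and i
  proof -
    have "(u + v) ^ (d - i) * v ^ i
        = (\<Sum>m\<le>d - i. of_nat ((d - i) choose m) * (v ^ (d - m) * u ^ m))"
      unfolding binomial_ring sum_distrib_right
    proof (rule sum.cong)
      fix m assume "m \<in> {..d - i}"
      then have "d - m = d - i - m + i" using that by auto
      then have "v ^ (d - m) = v ^ (d - i - m) * v ^ i"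
        by (simp only: power_add)
      then show "of_nat (d - i choose m) * u ^ m * v ^ (d - i - m) * v ^ i
          = of_nat (d - i choose m) * (v ^ (d - m) * u ^ m)"
        by (simp only: mult_ac)
    qed simp
    also have "\<dots> = (\<Sum>m\<le>d. of_nat ((d - i) choose m) * (v ^ (d - m) * u ^ m))"
      by (rule sum.mono_neutral_left) (auto simp: binomial_eq_0)
    finally show ?thesis .
  qed
  have 1: "(x + y) ^ (d - i) * y ^ i = (\<Sum>m\<le>d. of_nat ((d - i) choose m) * (y ^ (d - m) * x ^ m))"
    if "i \<le> d" for i
    using expand[OF that] .
  have 2: "(x + y) ^ (d - i) * x ^ i = (\<Sum>m\<le>d. of_nat ((d - i) choose (d - m)) * (y ^ (d - m) * x ^ m))"
    if "i \<le> d" for i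
  proof -
    have "(x + y) ^ (d - i) * x ^ i = (\<Sum>m\<le>d. of_nat ((d - i) choose m) * (x ^ (d - m) * y ^ m))"
      using expand[OF that, of y x] by (simp only: add.commute)
    also have "\<dots> = (\<Sum>m\<le>d. of_nat ((d - i) choose (d - m)) * (x ^ (d - (d - m)) * y ^ (d - m)))"
      by (rule sum_atMost_flip[symmetric])
    also have "\<dots> = (\<Sum>m\<le>d. of_nat ((d - i) choose (d - m)) * (y ^ (d - m) * x ^ m))"
      by (rule sum.cong) (auto simp: mult_ac)
    finally show ?thesis .
  qed
  have "gen_z (x + y) y + gen_z (x + y) x
      = (\<Sum>i\<le>d. [:z i:] * ((x + y) ^ (d - i) * y ^ i + (x + y) ^ (d - i) * x ^ i))"
    by (simp only: gen_z_def distrib_left sum.distrib)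
  also have "\<dots> = (\<Sum>i\<le>d. \<Sum>m\<le>d. [:z i:]
      * ((of_nat ((d - i) choose m) + of_nat ((d - i) choose (d - m))) * (y ^ (d - m) * x ^ m)))"
    by (rule sum.cong) (simp_all only: atMost_iff 1 2 sum_distrib_left distrib_left distrib_right sum.distrib)
  also have "\<dots> = (\<Sum>m\<le>d. \<Sum>i\<le>d. [:z i:]
      * ((of_nat ((d - i) choose m) + of_nat ((d - i) choose (d - m))) * (y ^ (d - m) * x ^ m)))"
    by (rule sum.swap)
  also have "\<dots> = (\<Sum>m\<le>d. [:p m:] * (y ^ (d - m) * x ^ m))"
  proof (rule sum.cong)
    fix m assume "m \<in> {..d}"
    then have "[:p m:] = [:\<Sum>i\<le>d. (real ((d - i) choose m) + real ((d - i) choose (d - m))) * z i:]"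
      by (simp add: shuffle)
    also have "\<dots> = (\<Sum>i\<le>d. [:(real ((d - i) choose m) + real ((d - i) choose (d - m))) * z i:])"
      by (rule sum_to_poly[symmetric])
    also have "\<dots> = (\<Sum>i\<le>d. [:z i:] * (of_nat ((d - i) choose m) + of_nat ((d - i) choose (d - m))))"
      by (simp add: of_nat_poly mult.commute)
    finally have "[:p m:] = (\<Sum>i\<le>d. [:z i:] * (of_nat ((d - i) choose m) + of_nat ((d - i) choose (d - m))))" .
    then show "(\<Sum>i\<le>d. [:z i:]
        * ((of_nat ((d - i) choose m) + of_nat ((d - i) choose (d - m))) * (y ^ (d - m) * x ^ m)))
        = [:p m:] * (y ^ (d - m) * x ^ m)"
      by (simp only: sum_distrib_right mult.assoc)
  qed simp
  finally show ?thesis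
    by (simp only: gen_p_flip)
qed

text \<open>Every monomial has total degree \<open>d\<close>; this is how the odd weight enters the
  dihedral argument.\<close>

lemma gen_odd: "gen_z (- x) (- y) = - gen_z x y"
proof -
  have "(- x) ^ (d - i) * (- y) ^ i = - (x ^ (d - i) * y ^ i)" if "i \<le> d" for i
  proof -
    have "(- x) ^ (d - i) * (- y) ^ i = (- 1) ^ (d - i + i) * (x ^ (d - i) * y ^ i)"
      by (simp only: power_minus[of x] power_minus[of y] power_add mult_ac)
    then show ?thesis using that odd_d by simp
  qed
  then show ?thesis
    by (simp add: gen_z_def sum_negf[symmetric])
qed

text \<open>Both sides are the coefficient of \<open>x\<^sup>d\<^sup>-\<^sup>i\<close> in \<open>gen_z x 1\<close>.\<close>

lemma odd_double_shuffle_coeff: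
  assumes "i \<le> d"
  shows "z i = (\<Sum>m | m \<le> d \<and> even m. p m *
      ((if m = i then 1 else 0) - (- 1) ^ i * (real (m choose i) + real (m choose (d - i)))))
      - \<zeta> / 2 * (1 - (- 1) ^ i * real ((d + 2) choose (i + 1)))"
proof -
  \<comment> \<open>The solution is specialized to x = \<open>X\<close> and y = 1, so that y - x
    becomes \<open>Y\<close>.\<close>
  define X :: "real poly" where "X = monom 1 1"
  define Y :: "real poly" where "Y = [:1, - 1:]"
  have Y: "1 - X = Y" by (simp add: X_def Y_def monom_altdef one_pCons)
  define n where "n = d - i"
  have sgn_n: "(- 1 :: real) ^ n = - ((- 1) ^ i)"
    using odd_d assms by (auto simp: n_def minus_one_power_iff)
  have coeff_Y: "coeff (Y ^ m) l = (- 1) ^ l * real (m choose l)" for m l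
    by (cases "l \<le> m") (simp_all add: Y_def coeff_linear_poly_power coeff_eq_0 degree_linear_power binomial_eq_0
        degree_power_eq)
  have coeff_X: "coeff (X ^ m) l = (if l = m then 1 else 0)" for m l
    by (simp add: X_def monom_power)
  have sgn: "(- 1 :: real poly) ^ m + 1 = (if even m then 2 else 0)" for m
    by (simp add: minus_one_power_iff)
  \<comment> \<open>In each of the three differences one argument changes sign. As \<open>d\<close>
    is odd, the terms with odd m cancel and those with even m double, with a minus sign in
    \<open>P2\<close>.\<close>
  have P1: "gen_p X 1 - gen_p (- X) 1 = (\<Sum>m\<le>d. [:p m:] * ((if even m then 2 else 0) * X ^ (d - m)))"
  proof -
    have "gen_p (- X) 1 = (\<Sum>m\<le>d. [:p m:] * (- ((- 1) ^ m * X ^ (d - m))))"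
      unfolding gen_p_def
      by (rule sum.cong) (use odd_d in \<open>auto simp: power_minus[of X] minus_one_power_iff\<close>)
    then show ?thesis
      unfolding gen_p_def by (simp add: sgn[symmetric] algebra_simps sum.distrib sum_negf)
  qed
  have P2: "gen_p Y (- X) - gen_p Y X = (\<Sum>m\<le>d. [:p m:] * (- (if even m then 2 else 0) * (X ^ (d - m) * Y ^ m)))"
  proof -
    have "gen_p Y (- X) = (\<Sum>m\<le>d. [:p m:] * (- ((- 1) ^ m * (X ^ (d - m) * Y ^ m))))"
      unfolding gen_p_flip[of Y]
      by (rule sum.cong) (use odd_d in \<open>auto simp: power_minus[of X] minus_one_power_iff\<close>)
    then show ?thesis
      unfolding gen_p_flip[of Y X] by (simp only: sum_subtractf[symmetric])
        (rule sum.cong, auto simp: sgn[symmetric] algebra_simps)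
  qed
  have P3: "gen_p 1 Y - gen_p (- 1) Y = (\<Sum>m\<le>d. [:p m:] * ((if even m then 2 else 0) * Y ^ m))"
  proof -
    have "gen_p (- 1) Y = (\<Sum>m\<le>d. [:p m:] * (- ((- 1) ^ m * Y ^ m)))"
      unfolding gen_p_def
      by (rule sum.cong) (use odd_d in \<open>auto simp: minus_one_power_iff\<close>)
    then show ?thesis
      unfolding gen_p_def by (simp add: sgn[symmetric] algebra_simps sum.distrib sum_negf)
  qed
  \<comment> \<open>Removing X^(d-m) leaves the coefficient of degree n - (d - m) = m - i in
    Y^m.\<close>
  have cXY: "coeff (X ^ (d - m) * Y ^ m) n = (- 1) ^ m * (- 1) ^ i * real (m choose i)" if "m \<le> d" for m
  proof (cases "i \<le> m")
    case True
    then have "n = (d - m) + (m - i)" using that by (simp add: n_def)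
    then have "coeff (X ^ (d - m) * Y ^ m) n = coeff (Y ^ m) (m - i)"
      by (simp add: X_def monom_power coeff_monom_mult)
    also have "\<dots> = (- 1) ^ (m - i) * real (m choose i)"
      by (simp add: coeff_Y True flip: binomial_symmetric)
    also have "(- 1 :: real) ^ (m - i) = (- 1) ^ m * (- 1) ^ i"
      using True by (simp add: minus_one_power_iff)
    finally show ?thesis .
  next
    case False
    then have "n < d - m" using that assms by (simp add: n_def)
    then show ?thesis
      using False by (simp add: X_def monom_power coeff_monom_mult binomial_eq_0)
  qed
  \<comment> \<open>The factor u - v is \<open>X\<close> for the pair (1, \<open>Y\<close>) and 1
    for the pair (\<open>Y\<close>, \<open>- X\<close>), so it is harmless in both cases.\<close>
  have pow_diff: "(u - v) * gen_1 u v = u ^ Suc d - v ^ Suc d" for u v :: "real poly"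
    unfolding gen_1_def by (simp only: diff_power_eq_sum lessThan_Suc_atMost)
  have S1: "coeff (gen_1 X 1) n = 1"
    by (simp add: gen_1_def coeff_sum coeff_X n_def)
  have S2: "coeff (gen_1 1 Y) n = (- 1) ^ n * real ((d + 1) choose (n + 1))"
  proof -
    have "X * gen_1 1 Y = 1 - Y ^ Suc d"
      using pow_diff[of 1 Y] by (simp flip: Y)
    then have "coeff (X * gen_1 1 Y) (Suc n) = coeff (1 - Y ^ Suc d) (Suc n)" by simp
    then show ?thesis
      by (simp add: X_def coeff_monom_mult coeff_Y del: power_Suc) simp
  qed
  have S3: "coeff (gen_1 Y (- X)) n = (- 1) ^ n * real ((d + 1) choose n)"
  proof -
    have "gen_1 Y (- X) = Y ^ Suc d - (- 1) ^ Suc d * X ^ Suc d"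
      using pow_diff[of Y "- X"] by (simp flip: Y power_minus)
    then have "gen_1 Y (- X) = Y ^ Suc d - X ^ Suc d"
      using odd_d by (simp del: power_Suc)
    then show ?thesis
      by (simp add: coeff_Y coeff_X n_def del: power_Suc)
  qed
  have "2 * gen_z X 1 = (gen_p X 1 - gen_p (- X) 1) + (gen_p Y (- X) - gen_p Y X)
      + (gen_p 1 Y - gen_p (- 1) Y)
      - ([:\<zeta>:] * gen_1 X 1 + [:\<zeta>:] * gen_1 1 Y + [:\<zeta>:] * gen_1 Y (- X))"
    using odd_double_shuffle_solution[of gen_z gen_p "\<lambda>x y. [:\<zeta>:] * gen_1 x y" X 1,
        OF gen_stuffle gen_shuffle gen_odd]
    unfolding Y .
  also have "(gen_p X 1 - gen_p (- X) 1) + (gen_p Y (- X) - gen_p Y X) + (gen_p 1 Y - gen_p (- 1) Y)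
      = (\<Sum>m\<le>d. [:p m * (if even m then 2 else 0):] * (X ^ (d - m) - X ^ (d - m) * Y ^ m + Y ^ m))"
    unfolding P1 P2 P3 sum.distrib[symmetric]
    by (rule sum.cong) (auto simp: algebra_simps numeral_poly smult_add_right)
  finally have eq: "2 * gen_z X 1
      = (\<Sum>m\<le>d. [:p m * (if even m then 2 else 0):] * (X ^ (d - m) - X ^ (d - m) * Y ^ m + Y ^ m))
        - ([:\<zeta>:] * gen_1 X 1 + [:\<zeta>:] * gen_1 1 Y + [:\<zeta>:] * gen_1 Y (- X))" .
  have "2 * coeff (gen_z X 1) n = coeff (2 * gen_z X 1) n"
    by (simp add: numeral_poly)
  also have "\<dots> = (\<Sum>m\<le>d. coeff ([:p m * (if even m then 2 else 0):] * (X ^ (d - m) - X ^ (d - m) * Y ^ m + Y ^ m)) n)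
      - \<zeta> * (1 + (- 1) ^ n * real ((d + 1) choose (n + 1)) + (- 1) ^ n * real ((d + 1) choose n))"
    by (simp only: eq coeff_diff coeff_sum) (simp add: S1 S2 S3 distrib_left)
  also have "(\<Sum>m\<le>d. coeff ([:p m * (if even m then 2 else 0):] * (X ^ (d - m) - X ^ (d - m) * Y ^ m + Y ^ m)) n)
      = (\<Sum>m\<le>d. p m * (if even m then 2 else 0) * ((if m = i then 1 else 0)
         - (- 1) ^ m * (- 1) ^ i * real (m choose i) + (- 1) ^ n * real (m choose n)))"
  proof (rule sum.cong)
    fix m assume "m \<in> {..d}"
    then have "m \<le> d" by simp
    moreover have "n = d - m \<longleftrightarrow> m = i" using assms \<open>m \<le> d\<close> by (auto simp: n_def)
    ultimately show "coeff ([:p m * (if even m then 2 else 0):] * (X ^ (d - m) - X ^ (d - m) * Y ^ m + Y ^ m)) n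
      = p m * (if even m then 2 else 0) * ((if m = i then 1 else 0)
         - (- 1) ^ m * (- 1) ^ i * real (m choose i) + (- 1) ^ n * real (m choose n))"
      by (simp add: coeff_X coeff_Y cXY)
  qed simp
  finally have e1: "2 * coeff (gen_z X 1) n =
      (\<Sum>m\<le>d. p m * (if even m then 2 else 0) * ((if m = i then 1 else 0)
         - (- 1) ^ m * (- 1) ^ i * real (m choose i) + (- 1) ^ n * real (m choose n)))
      - \<zeta> * (1 + (- 1) ^ n * real ((d + 1) choose (n + 1)) + (- 1) ^ n * real ((d + 1) choose n))" .
  have e2: "coeff (gen_z X 1) n = z i"
  proof -
    have "coeff (gen_z X 1) n = (\<Sum>j\<le>d. if j = i then z j else 0)"
      unfolding gen_z_def coeff_sum
      by (rule sum.cong) (use assms in \<open>auto simp: coeff_X n_def\<close>)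
    then show ?thesis using assms by simp
  qed
  have e3: "(\<Sum>m\<le>d. p m * (if even m then 2 else 0) * ((if m = i then 1 else 0)
         - (- 1) ^ m * (- 1) ^ i * real (m choose i) + (- 1) ^ n * real (m choose n)))
      = 2 * (\<Sum>m | m \<le> d \<and> even m. p m *
          ((if m = i then 1 else 0) - (- 1) ^ i * (real (m choose i) + real (m choose n))))"
    unfolding sum_distrib_left
    by (rule sum.mono_neutral_cong_right) (auto simp: sgn_n algebra_simps)
  \<comment> \<open>Pascal's rule, followed by the symmetry (i + 1) + (n + 1) = d + 2.\<close>
  have e4: "1 + (- 1) ^ n * real ((d + 1) choose (n + 1)) + (- 1) ^ n * real ((d + 1) choose n)
      = 1 - (- 1) ^ i * real ((d + 2) choose (i + 1))"
  proof -
    have "(d + 2) choose (i + 1) = (d + 2) choose (n + 1)"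
      using binomial_symmetric[of "i + 1" "d + 2"] assms by (simp add: n_def Suc_diff_le)
    then have "(d + 2) choose (i + 1) = ((d + 1) choose (n + 1)) + ((d + 1) choose n)"
      by simp
    then show ?thesis
      unfolding sgn_n by (simp only: of_nat_add distrib_left minus_mult_left[symmetric])
  qed
  have halve: "u = v - c / 2 * t" if "2 * u = 2 * v - c * t" for u v c t :: real
    using that by (simp add: field_simps)
  show ?thesis
    using halve[OF e1[unfolded e2 e3 e4]] unfolding n_def .
qed

end

section \<open>Linear functionals on tensors\<close>

text \<open>The linear functional extending \<open>h\<close>; since tensors are only
  representatives, they are compared through such functionals.\<close>

definition rat_ext :: "('a \<Rightarrow> rat) \<Rightarrow> ('a \<Rightarrow>\<^sub>0 rat) \<Rightarrow> rat" where
  "rat_ext h t = (\<Sum>k\<in>Poly_Mapping.keys t. Poly_Mapping.lookup t k * h k)"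

lemma rat_ext_superset:
  assumes "finite A" "Poly_Mapping.keys t \<subseteq> A"
  shows "rat_ext h t = (\<Sum>k\<in>A. Poly_Mapping.lookup t k * h k)"
  unfolding rat_ext_def by (rule sum.mono_neutral_left) (use assms in \<open>auto simp: in_keys_iff\<close>)

lemma rat_ext_add [simp]: "rat_ext h (t + u) = rat_ext h t + rat_ext h u"
proof -
  let ?A = "Poly_Mapping.keys t \<union> Poly_Mapping.keys u"
  have "rat_ext h (t + u) = (\<Sum>k\<in>?A. Poly_Mapping.lookup (t + u) k * h k)"
    by (rule rat_ext_superset) (use keys_add[of t u] in auto)
  moreover have "rat_ext h t = (\<Sum>k\<in>?A. Poly_Mapping.lookup t k * h k)"
    by (rule rat_ext_superset) auto
  moreover have "rat_ext h u = (\<Sum>k\<in>?A. Poly_Mapping.lookup u k * h k)"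
    by (rule rat_ext_superset) auto
  ultimately show ?thesis
    by (simp add: lookup_add distrib_right sum.distrib)
qed

lemma rat_ext_rsmult [simp]: "rat_ext h (rsmult c t) = c * rat_ext h t"
proof -
  have "rat_ext h (rsmult c t) = (\<Sum>k\<in>Poly_Mapping.keys t. Poly_Mapping.lookup (rsmult c t) k * h k)"
    by (rule rat_ext_superset) (auto simp: in_keys_iff)
  then show ?thesis
    by (simp add: rat_ext_def sum_distrib_left mult.assoc)
qed

lemma rat_ext_0 [simp]: "rat_ext h 0 = 0"
  by (simp add: rat_ext_def)

lemma rat_ext_basis [simp]: "rat_ext h (basis k) = h k"
  by (simp add: rat_ext_def)

lemma rat_ext_diff [simp]: "rat_ext h (t - u) = rat_ext h t - rat_ext h u"
  using rat_ext_add[of h "t - u" u] by simp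

lemma rat_ext_sum [simp]: "rat_ext h (\<Sum>i\<in>I. t i) = (\<Sum>i\<in>I. rat_ext h (t i))"
  by (induction I rule: infinite_finite_induct) auto

lemma lookup_sum_poly: "Poly_Mapping.lookup (\<Sum>i\<in>I. t i) k = (\<Sum>i\<in>I. Poly_Mapping.lookup (t i) k)"
  by (induction I rule: infinite_finite_induct) (auto simp: lookup_add)

lemma lookup_sum_mset_poly:
  "Poly_Mapping.lookup (\<Sum>i\<in>#M. t i) k = (\<Sum>i\<in>#M. Poly_Mapping.lookup (t i) k)"
  by (induction M) (auto simp: lookup_add)

lemma lookup_lin_ext: "Poly_Mapping.lookup (lin_ext g x) k = rat_ext (\<lambda>i. Poly_Mapping.lookup (g i) k) x"
  by (simp add: lin_ext_def rat_ext_def lookup_sum_poly)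

lemma lookup_bilin_ext:
  "Poly_Mapping.lookup (bilin_ext g x y) k
     = rat_ext (\<lambda>i. rat_ext (\<lambda>j. Poly_Mapping.lookup (g i j) k) y) x"
  by (simp add: bilin_ext_def lookup_lin_ext)

lemma rat_ext_cong:
  assumes "\<And>k. k \<in> Poly_Mapping.keys t \<Longrightarrow> h k = h' k"
  shows "rat_ext h t = rat_ext h' t"
  unfolding rat_ext_def by (rule sum.cong) (auto simp: assms)

lemma rat_ext_eq_0:
  assumes "\<And>k. k \<in> Poly_Mapping.keys t \<Longrightarrow> h k = 0"
  shows "rat_ext h t = 0"
  unfolding rat_ext_def by (rule sum.neutral) (auto simp: assms)

lemma rat_ext_indicator [simp]: "rat_ext (\<lambda>i. if i = k then c else 0) t = Poly_Mapping.lookup t k * c"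
  by (cases "k \<in> Poly_Mapping.keys t")
    (auto simp: rat_ext_def if_distrib[of "\<lambda>x. _ * x"] sum.delta in_keys_iff cong: if_cong)

lemma rat_ext_mult_right: "rat_ext (\<lambda>i. h i * c) t = rat_ext h t * c"
  by (simp add: rat_ext_def sum_distrib_right mult.assoc)

text \<open>The functional g \<otimes> h is well defined on the tensor product: linearity of g and h
  kills the bilinearity relations, and g kills \<open>K\<close>. Thus \<open>tensor_eq\<close>
  becomes an equality of rational numbers.\<close>

lemma rat_ext_tensor_null:
  fixes g h :: "'h::ab_group_add \<Rightarrow> rat"
  assumes g: "\<And>x y. g (x + y) = g x + g y" "\<And>c x. g (smul c x) = c * g x"
    and h: "\<And>x y. h (x + y) = h x + h y" "\<And>c x. h (smul c x) = c * h x"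
    and K: "\<And>x. x \<in> K \<Longrightarrow> g x = 0"
    and t: "t \<in> tensor_null smul K"
  shows "rat_ext (\<lambda>(x, y). g x * h y) t = 0"
proof -
  let ?N = "{t. rat_ext (\<lambda>(x, y). g x * h y) t = 0}"
  have "free.subspace ?N"
    by (rule free.subspaceI) auto
  then have "tensor_null smul K \<subseteq> ?N"
    unfolding tensor_null_def
    by (intro free.span_minimal) (auto simp: g h K distrib_left distrib_right mult_ac)
  then show ?thesis using t by auto
qed

section \<open>Shuffles of words of small depth\<close>

lemma shuffle_mset_Nil_right [simp]: "shuffle_mset u [] = {#u#}"
  by (cases u) auto

lemma shuffle_mset_commute: "shuffle_mset u v = shuffle_mset v u"
  by (induction u v rule: shuffle_mset.induct) (simp_all add: add.commute)

lemma length_shuffle: "w \<in># shuffle_mset u v \<Longrightarrow> length w = length u + length v"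
  by (induction u v arbitrary: w rule: shuffle_mset.induct) auto

lemma shuffle_single_replicate:
  "shuffle_mset [x] (replicate k x) = replicate_mset (Suc k) (replicate (Suc k) x)"
  by (induction k) (auto simp: image_replicate_mset)

text \<open>The new \<open>x\<close> has k + 1 slots before \<open>y\<close> and m + 1 after it;
  slots on the same side give the same word.\<close>

lemma shuffle_zero_depth_one:
  "shuffle_mset [x] (replicate k x @ y # replicate m x)
     = replicate_mset (Suc k) (replicate (Suc k) x @ y # replicate m x)
       + replicate_mset (Suc m) (replicate k x @ y # replicate (Suc m) x)"
proof (induction k)
  case 0
  show ?case
    using shuffle_single_replicate[of x m] by (auto simp: image_replicate_mset)
qed (auto simp: image_replicate_mset)

lemma shuffle_replicate:
  "shuffle_mset (replicate m x) (replicate n x) = replicate_mset ((m + n) choose m) (replicate (m + n) x)"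
proof (induction "m + n" arbitrary: m n)
  case (Suc l)
  show ?case
  proof (cases "m = 0 \<or> n = 0")
    case False
    then obtain m' n' where mn: "m = Suc m'" "n = Suc n'"
      by (metis not0_implies_Suc)
    have "shuffle_mset (replicate m' x) (replicate n x)
        = replicate_mset ((m' + n) choose m') (replicate (m' + n) x)"
      "shuffle_mset (replicate m x) (replicate n' x)
        = replicate_mset ((m + n') choose m) (replicate (m + n') x)"
      using Suc.hyps(1)[of m' n] Suc.hyps(1)[of m n'] Suc.hyps(2) mn by auto
    then show ?thesis
      by (auto intro!: multiset_eqI simp: mn image_replicate_mset)
  qed auto
qed simp

text \<open>Here i counts the copies of \<open>x\<close> in front of \<open>y\<close>; behind it,
  the other m - i copies interleave with the n given ones in (m + n - i) choose n ways.\<close>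

lemma sum_shuffle_replicate_depth_one:
  fixes f :: "'a list \<Rightarrow> 'b::comm_semiring_1"
  shows "(\<Sum>w\<in>#shuffle_mset (replicate m x) (y # replicate n x). f w)
     = (\<Sum>i\<le>m. of_nat ((m + n - i) choose n) * f (replicate i x @ y # replicate (m + n - i) x))"
proof (induction m arbitrary: f)
  case (Suc m)
  have "shuffle_mset (replicate (Suc m) x) (y # replicate n x)
      = image_mset ((#) x) (shuffle_mset (replicate m x) (y # replicate n x))
        + replicate_mset ((Suc m + n) choose n) (y # replicate (Suc m + n) x)"
    using shuffle_replicate[of "Suc m" x n] binomial_symmetric[of n "Suc m + n"]
    by (simp add: image_replicate_mset)
  then have "(\<Sum>w\<in>#shuffle_mset (replicate (Suc m) x) (y # replicate n x). f w)
      = (\<Sum>w\<in>#shuffle_mset (replicate m x) (y # replicate n x). (f \<circ> (#) x) w)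
        + of_nat ((Suc m + n) choose n) * f (y # replicate (Suc m + n) x)"
    by (simp add: sum_mset_replicate_mset multiset.map_comp comp_def)
  also have "\<dots> = (\<Sum>i\<le>Suc m. of_nat ((Suc m + n - i) choose n) * f (replicate i x @ y # replicate (Suc m + n - i) x))"
    unfolding Suc.IH sum.atMost_Suc_shift by (simp add: add.commute)
  finally show ?case .
qed simp

section \<open>Operations on the f-alphabet\<close>

lemma lookup_mod_f2: "Poly_Mapping.lookup (mod_f2 x) w = Poly_Mapping.lookup x (w, 0)"
proof -
  have "(\<lambda>i. Poly_Mapping.lookup (case i of (w, k) \<Rightarrow> if k = 0 then basis w else 0) w)
      = (\<lambda>i. if i = (w, 0 :: nat) then 1 else 0 :: rat)"
    by (auto simp: lookup_single)
  then show ?thesis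
    by (simp add: mod_f2_def lookup_lin_ext)
qed

lemma lookup_tensor_map:
  fixes f :: "'h \<Rightarrow> ('i \<Rightarrow>\<^sub>0 rat)" and g :: "'h \<Rightarrow> ('j \<Rightarrow>\<^sub>0 rat)"
  shows "Poly_Mapping.lookup (tensor_map f g t) (i, j)
     = rat_ext (\<lambda>(x, y). Poly_Mapping.lookup (f x) i * Poly_Mapping.lookup (g y) j) t"
proof -
  have "(\<lambda>j'. Poly_Mapping.lookup (basis (i', j')) (i, j))
      = (\<lambda>j'. if j' = j then if i' = i then 1 else 0 else 0 :: rat)" for i' :: 'i
    by (auto simp: lookup_single)
  then show ?thesis
    unfolding tensor_map_def lookup_lin_ext
    by (intro rat_ext_cong) (auto simp: lookup_bilin_ext if_distrib[of "\<lambda>x. _ * x"] mult.commute cong: if_cong)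
qed

text \<open>A left factor of length one arises only from the cut after the first letter, so these
  coordinates of the coaction are those of the derivative with respect to f_r.\<close>

lemma lookup_deconcatenate_letter:
  "Poly_Mapping.lookup (deconcatenate x) ([r], (u, k)) = Poly_Mapping.lookup x (r # u, k)"
proof -
  have "(\<Sum>i\<le>length w. Poly_Mapping.lookup (basis (take i w, drop i w, l)) ([r], u, k))
      = (if (w, l) = (r # u, k) then 1 else 0 :: rat)" for w :: "nat list" and l :: nat
  proof (cases "(w, l) = (r # u, k)")
    case True
    then have "(\<Sum>i\<le>length w. Poly_Mapping.lookup (basis (take i w, drop i w, l)) ([r], u, k))
        = (\<Sum>i\<le>length w. if i = 1 then 1 else 0 :: rat)"
      by (intro sum.cong) (auto simp: lookup_single take_Cons' when_def)
    then show ?thesis using True by simp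
  next
    case False
    have "(take i w, drop i w, l) \<noteq> ([r], u, k)" for i
      using False append_take_drop_id[of i w] by (metis append_Cons append_Nil prod.inject)
    then have "Poly_Mapping.lookup (basis (take i w, drop i w, l)) ([r], u, k) = (0 :: rat)" for i
      by (rule lookup_single_not_eq)
    then show ?thesis using False by simp
  qed
  then have "(\<lambda>p. Poly_Mapping.lookup (case p of (w, l) \<Rightarrow> \<Sum>i\<le>length w. basis (take i w, drop i w, l)) ([r], u, k))
      = (\<lambda>p. if p = (r # u, k) then 1 else 0 :: rat)"
    by (auto simp: lookup_sum_poly fun_eq_iff)
  then show ?thesis
    by (simp add: deconcatenate_def lookup_lin_ext)
qed

lemma lookup_f_conc_letter:
  assumes "odd r"
  shows "Poly_Mapping.lookup (f_conc (f_gen r) g) (w, k)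
    = (if w \<noteq> [] \<and> hd w = r then Poly_Mapping.lookup g (tl w, k) else 0)"
proof -
  have "Poly_Mapping.lookup (f_conc (f_gen r) g) (w, k)
      = rat_ext (\<lambda>j. Poly_Mapping.lookup (basis (r # fst j, snd j)) (w, k)) g"
    using assms by (simp add: f_conc_def f_gen_def lookup_bilin_ext case_prod_unfold)
  also have "\<dots> = rat_ext (\<lambda>j. if j = (tl w, k) then if w \<noteq> [] \<and> hd w = r then 1 else 0 else 0) g"
    by (rule rat_ext_cong) (cases w, auto simp: lookup_single when_def)
  finally show ?thesis by simp
qed

lemma f_conc_rsmult: "f_conc x (rsmult c y) = rsmult c (f_conc x y)"
  by (rule poly_mapping_eqI)
    (simp add: f_conc_def lookup_bilin_ext mult.commute[of c] flip: rat_ext_mult_right)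

text \<open>For even n the word of \<open>f_gen n\<close> is empty, and shuffling with the empty
  word is concatenation.\<close>

lemma U_mult_f_gen:
  assumes "odd r" "even n"
  shows "U_mult (f_gen r) (f_gen n) = f_conc (f_gen r) (f_gen n)"
  using assms by (intro poly_mapping_eqI)
    (simp add: U_mult_def f_conc_def f_gen_def f2_power_def lookup_bilin_ext)

text \<open>Word lengths and exponents of f_2 add up, so \<open>([r], 0)\<close> can only come from
  a pair of basis elements one of which is \<open>([], 0)\<close>.\<close>

lemma lookup_U_mult_letter:
  assumes "Poly_Mapping.lookup x ([], 0) = 0" "Poly_Mapping.lookup y ([], 0) = 0"
  shows "Poly_Mapping.lookup (U_mult x y) ([r], 0) = 0"
  unfolding U_mult_def lookup_bilin_ext
proof (intro rat_ext_eq_0)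
  fix p q assume p: "p \<in> Poly_Mapping.keys x" and q: "q \<in> Poly_Mapping.keys y"
  obtain u i where p': "p = (u, i)" by force
  obtain v j where q': "q = (v, j)" by force
  have nz: "(u, i) \<noteq> ([], 0)" "(v, j) \<noteq> ([], 0)"
    using p q assms by (metis in_keys_iff p' q')+
  have "Poly_Mapping.lookup (basis (w, i + j)) ([r], 0) = (0 :: rat)" if "w \<in># shuffle_mset u v" for w
    using length_shuffle[OF that] nz by (intro lookup_single_not_eq) (cases u; cases v; auto)
  then show "Poly_Mapping.lookup ((case p of (u, i) \<Rightarrow> \<lambda>(v, j). \<Sum>w\<in>#shuffle_mset u v. basis (w, i + j)) q) ([r], 0) = 0"
    by (simp add: p' q' lookup_sum_mset_poly cong: image_mset_cong)
qed

section \<open>Derivatives of motivic multiple zeta values\<close>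

locale mzv_f_alphabet =
  motivic_mzv smul gr Imot per coact + normalized_iso smul gr Imot coact \<phi>
  for smul :: "rat \<Rightarrow> 'h::comm_ring_1 \<Rightarrow> 'h"
    and gr :: "nat \<Rightarrow> 'h set"
    and Imot :: "bool \<Rightarrow> bool list \<Rightarrow> bool \<Rightarrow> 'h"
    and per :: "'h \<Rightarrow> real"
    and coact :: "'h \<Rightarrow> ('h \<times> 'h \<Rightarrow>\<^sub>0 rat)"
    and \<phi> :: "'h \<Rightarrow> fpoly"
begin

text \<open>In particular \<open>coef [r] 0\<close> is c_r composed with
  \<open>\<phi>\<close>.\<close>

abbreviation coef :: "nat list \<Rightarrow> nat \<Rightarrow> 'h \<Rightarrow> rat" where
  "coef w k x \<equiv> Poly_Mapping.lookup (\<phi> x) (w, k)"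

lemma phi_zero [simp]: "\<phi> 0 = 0"
  using iso_add[of 0 0] by simp

lemma phi_minus [simp]: "\<phi> (- x) = - \<phi> x"
  using iso_add[of x "- x"] by (simp add: eq_neg_iff_add_eq_0 add.commute)

lemma phi_sum: "\<phi> (\<Sum>i\<in>I. x i) = (\<Sum>i\<in>I. \<phi> (x i))"
  by (induction I rule: infinite_finite_induct) (simp_all add: iso_add)

lemma phi_eqD: "\<phi> x = \<phi> y \<Longrightarrow> x = y"
  using iso_bij by (auto dest: bij_betw_imp_inj_on injD)

lemma per_zero [simp]: "per 0 = 0"
  using per_add[of 0 0] by simp

lemma per_minus: "per (- x) = - per x"
  using per_add[of x "- x"] by simp

lemma per_sum: "per (\<Sum>i\<in>I. x i) = (\<Sum>i\<in>I. per (x i))"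
  by (induction I rule: infinite_finite_induct) (simp_all add: per_add)

lemma per_of_nat: "per (of_nat n) = of_nat n"
  by (induction n) (simp_all add: per_add per_one)

lemma per_of_int: "per (of_int n) = of_int n"
  by (cases n rule: int_cases2) (simp_all add: per_of_nat per_minus)

lemma per_power: "per (x ^ n) = per x ^ n"
  by (induction n) (simp_all add: per_mult per_one)

lemma smul_of_nat: "smul (of_nat n) x = of_nat n * x"
  by (induction n) (simp_all add: scale_left_distrib distrib_right)

lemma smul_of_int: "smul (of_int n) x = of_int n * x"
  by (cases n) (simp_all add: smul_of_nat scale_left_distrib distrib_right scale_left_diff_distrib left_diff_distrib)

text \<open>Only additivity and multiplicativity of \<open>per\<close> are given; rational linearity
  follows by clearing denominators.\<close>

lemma per_smul: "per (smul c x) = of_rat c * per x"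
proof -
  obtain m n where c: "c = of_int m / of_int n" and n: "n \<noteq> 0"
    by (metis quotient_of_div quotient_of_denom_pos less_irrefl surj_pair)
  have "of_int n * smul c x = smul (of_int n * c) x"
    by (simp add: smul_of_int[symmetric])
  also have "\<dots> = of_int m * x"
    using n by (simp add: c smul_of_int)
  finally have "of_int n * per (smul c x) = of_int m * per x"
    by (metis per_mult per_of_int)
  then show ?thesis
    using n by (simp add: c of_rat_divide field_simps)
qed

lemma Imot_in_gr: "Imot e0 w e1 \<in> gr (length w)"
  unfolding gr_span by (rule span_base) auto

lemma coef_gr:
  assumes "x \<in> gr n" "coef w k x \<noteq> 0"
  shows "w \<in> f_words" "sum_list w + 2 * k = n"
proof -
  have "\<phi> x \<in> U_gr n"
    using iso_graded assms(1) by blast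
  moreover have "(w, k) \<in> Poly_Mapping.keys (\<phi> x)"
    using assms(2) by (simp add: in_keys_iff)
  ultimately show "w \<in> f_words" "sum_list w + 2 * k = n"
    by (auto simp: U_gr_def U_def)
qed

lemma subspace_coef_zero: "subspace {x. coef w k x = 0}"
  by (rule subspaceI) (simp_all add: iso_add iso_scale lookup_add)

text \<open>This makes c_r well defined on the quotient by products and zeta(2): elements of
  positive degree have no constant term, and multiples of zeta(2) become multiples of f_2.\<close>

lemma coef_L_kernel:
  assumes "x \<in> L_kernel smul gr Imot"
  shows "coef [r] 0 x = 0"
proof -
  have pos: "coef [] 0 y = 0" if "y \<in> positive_part smul gr" for y
  proof -
    have "positive_part smul gr \<subseteq> {x. coef [] 0 x = 0}"
      unfolding positive_part_def
      by (intro span_minimal subspace_coef_zero) (auto dest: coef_gr(2))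
    then show ?thesis using that by auto
  qed
  have "L_kernel smul gr Imot \<subseteq> {x. coef [r] 0 x = 0}"
    unfolding L_kernel_def
  proof (intro span_minimal subspace_coef_zero Un_least subsetI)
    fix y assume "y \<in> A_kernel Imot"
    then obtain x where y: "y = zeta_mot Imot 2 * x" by (auto simp: A_kernel_def)
    have "coef [r] 0 y = rat_ext (\<lambda>_. 0) (\<phi> x)"
      unfolding y iso_mult iso_zeta2 U_mult_def f2_power_def lookup_bilin_ext rat_ext_basis
      by (rule rat_ext_cong) (auto simp: lookup_single)
    then show "y \<in> {x. coef [r] 0 x = 0}" by (simp add: rat_ext_def)
  next
    fix y assume "y \<in> {x * y |x y. x \<in> positive_part smul gr \<and> y \<in> positive_part smul gr}"
    then show "y \<in> {x. coef [r] 0 x = 0}"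
      by (auto simp: iso_mult intro!: lookup_U_mult_letter pos)
  qed
  then show ?thesis using assms by auto
qed

text \<open>The coordinate form of \<open>\<partial>\<^sub>r \<phi> = ((c\<^sub>r \<circ> \<phi>) \<otimes> \<phi>) \<circ> D\<^sub>r\<close>.\<close>

lemma coef_Imot:
  assumes r: "odd r" "3 \<le> r" "r + 2 \<le> length w"
  shows "coef (r # u) k (Imot e0 w e1)
    = (\<Sum>p = 0..length w - r.
        coef [r] 0 (Imot ((e0 # w @ [e1]) ! p) (take r (drop p w)) ((e0 # w @ [e1]) ! (p + r + 1)))
        * coef u k (Imot e0 (take p w @ drop (p + r) w) e1))"
proof -
  define G where "G = (\<lambda>(x, y). coef [r] 0 x * coef u k y)"
  define x where "x = Imot e0 w e1"
  have "coef (r # u) k x = rat_ext G (coact x)"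
    using arg_cong[OF iso_coact[of x], of "\<lambda>t. Poly_Mapping.lookup t ([r], (u, k))"]
    by (simp add: lookup_deconcatenate_letter lookup_tensor_map lookup_mod_f2 G_def)
  \<comment> \<open>The left factors of \<open>coact x\<close> are homogeneous, and c_r vanishes on
    every degree other than r.\<close>
  also have "\<dots> = rat_ext G (left_degree_part gr r (coact x))"
  proof -
    have zero: "coef [r] 0 y = 0" if "(y, y') \<in> Poly_Mapping.keys (coact x)" "y \<notin> gr r" for y y'
    proof -
      have "x \<in> gr (length w)" unfolding x_def by (rule Imot_in_gr)
      with that obtain i where "y \<in> gr i"
        using coact_graded by blast
      moreover from this have "i \<noteq> r" using that by auto
      ultimately show ?thesis using coef_gr(2)[of y i "[r]" 0] by auto
    qed
    show ?thesis
      unfolding left_degree_part_def rat_ext_def[of G "coact x"] rat_ext_sum rat_ext_rsmult rat_ext_basis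
      by (intro sum.mono_neutral_right) (auto simp: G_def intro: ccontr dest: zero)
  qed
  also have "\<dots> = rat_ext G (D_formula Imot r e0 w e1)"
  proof -
    have "left_degree_part gr r (coact x) - D_formula Imot r e0 w e1 \<in> tensor_null smul (L_kernel smul gr Imot)"
      using D_Im[OF r] unfolding tensor_eq_def x_def .
    from rat_ext_tensor_null[OF _ _ _ _ _ this, of "coef [r] 0" "coef u k"]
    show ?thesis
      by (simp add: G_def iso_add iso_scale lookup_add coef_L_kernel)
  qed
  finally show ?thesis
    by (simp add: x_def D_formula_def Let_def G_def)
qed

lemma sum_list_f_words: "u \<in> f_words \<Longrightarrow> u \<noteq> [] \<Longrightarrow> 3 \<le> sum_list u"
  by (cases u) (auto simp: f_words_def)

text \<open>A word whose first letter exceeds N - 2 leaves degree at most 1, too little for another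
  letter or for f_2, so it is f_N itself. The empty word occurs only as f_2^{N/2}.\<close>

lemma phi_eq_derivatives:
  assumes x: "x \<in> gr N"
    and deriv: "\<And>r u k. odd r \<Longrightarrow> 3 \<le> r \<Longrightarrow> r + 2 \<le> N \<Longrightarrow>
      coef (r # u) k x = Poly_Mapping.lookup (g r) (u, k)"
  shows "\<phi> x = (\<Sum>r | 3 \<le> r \<and> r \<le> N - 2 \<and> odd r. f_conc (f_gen r) (g r))
    + (if even N then rsmult (coef [] (N div 2) x) (f2_power (N div 2))
       else rsmult (coef [N] 0 x) (f_gen N))"
    (is "_ = sum _ ?R + ?rem")
proof (rule poly_mapping_eqI)
  fix p :: "nat list \<times> nat"
  obtain w k where p: "p = (w, k)" by force
  have fin: "finite ?R" by simp
  have lsum: "Poly_Mapping.lookup (\<Sum>r\<in>?R. f_conc (f_gen r) (g r)) (w, k)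
      = (if w \<noteq> [] \<and> hd w \<in> ?R then Poly_Mapping.lookup (g (hd w)) (tl w, k) else 0)"
  proof -
    have "Poly_Mapping.lookup (\<Sum>r\<in>?R. f_conc (f_gen r) (g r)) (w, k)
        = (\<Sum>r\<in>?R. if hd w = r then if w \<noteq> [] then Poly_Mapping.lookup (g (hd w)) (tl w, k) else 0 else 0)"
      unfolding lookup_sum_poly by (rule sum.cong) (auto simp: lookup_f_conc_letter)
    then show ?thesis
      using fin by (simp only: sum.delta') simp
  qed
  have rem: "Poly_Mapping.lookup ?rem (w, k) = (if w = [] \<and> even N \<and> k = N div 2 \<or> w = [N] \<and> odd N \<and> k = 0
      then coef w k x else 0)"
    by (auto simp: f2_power_def f_gen_def lookup_single when_def)
  have "coef w k x = (if w \<noteq> [] \<and> hd w \<in> ?R then Poly_Mapping.lookup (g (hd w)) (tl w, k) else 0)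
      + (if w = [] \<and> even N \<and> k = N div 2 \<or> w = [N] \<and> odd N \<and> k = 0 then coef w k x else 0)"
  proof (cases w)
    case Nil
    then show ?thesis
      using coef_gr(2)[OF x, of "[]" k] by (cases "coef [] k x = 0") auto
  next
    case (Cons r u)
    show ?thesis
    proof (cases "r \<in> ?R")
      case True
      then show ?thesis using Cons deriv[of r u k] by auto
    next
      case False
      have "w = [N] \<and> odd N \<and> k = 0" if nz: "coef w k x \<noteq> 0"
      proof -
        have w: "w \<in> f_words" "r + sum_list u + 2 * k = N"
          using coef_gr[OF x nz] Cons by auto
        then have "odd r" "3 \<le> r" "u \<in> f_words" using Cons by (auto simp: f_words_def)
        with False have "N < r + 2" by auto
        with w(2) have "sum_list u < 3" "k = 0" by auto
        then have "u = []" using sum_list_f_words[OF \<open>u \<in> f_words\<close>] by auto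
        then show ?thesis using w(2) \<open>k = 0\<close> \<open>odd r\<close> Cons by auto
      qed
      then show ?thesis using False Cons by auto
    qed
  qed
  then show "Poly_Mapping.lookup (\<phi> x) p = Poly_Mapping.lookup ((\<Sum>r\<in>?R. f_conc (f_gen r) (g r)) + ?rem) p"
    unfolding p lookup_add lsum rem .
qed

section \<open>Depth at most one\<close>

abbreviation depth_one :: "nat \<Rightarrow> nat \<Rightarrow> 'h" where
  "depth_one k m \<equiv> Imot False (replicate k False @ True # replicate m False) True"

lemma zeta_mot_depth_one: "1 \<le> n \<Longrightarrow> zeta_mot Imot n = - depth_one 0 (n - 1)"
  by (simp add: zeta_mot_def)

lemma of_nat_mult_eq_0D:
  assumes "of_nat (Suc n) * (x :: 'h) = 0"
  shows "x = 0"
proof -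
  have "smul (of_nat (Suc n)) x = 0"
    using assms by (simp only: smul_of_nat)
  then show ?thesis by (simp del: of_nat_Suc)
qed

text \<open>Shuffling the vanishing integral of a single 0 with k zeros gives k + 1 times the
  integral of k + 1 zeros.\<close>

lemma Imot_zeros:
  assumes "1 \<le> n"
  shows "Imot e0 (replicate n False) e1 = 0"
proof -
  obtain k where n: "n = Suc k" using assms by (cases n) auto
  have "0 = (\<Sum>w\<in>#shuffle_mset [False] (replicate k False). Imot e0 w e1)"
    using Im_shuffle[of e0 "[False]" e1 "replicate k False"] by (simp add: Im_single)
  then have "of_nat (Suc k) * Imot e0 (replicate n False) e1 = 0"
    by (simp add: shuffle_single_replicate sum_mset_replicate_mset n distrib_right)
  then show ?thesis by (rule of_nat_mult_eq_0D)
qed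

text \<open>Shuffling with \<open>I(0; 0; 1) = 0\<close> moves the leading zeros behind the 1.\<close>

lemma depth_one_eq: "depth_one k m = smul ((- 1) ^ k * of_nat ((m + k) choose k)) (depth_one 0 (m + k))"
proof (induction k arbitrary: m)
  case (Suc k)
  have "0 = (\<Sum>w\<in>#shuffle_mset [False] (replicate k False @ True # replicate m False). Imot False w True)"
    using Im_shuffle[of False "[False]" True "replicate k False @ True # replicate m False"]
    by (simp add: Im_single)
  then have "of_nat (Suc k) * depth_one (Suc k) m + of_nat (Suc m) * depth_one k (Suc m) = 0"
    unfolding shuffle_zero_depth_one by (simp add: sum_mset_replicate_mset distrib_right add_ac)
  then have "smul (of_nat (Suc k)) (depth_one (Suc k) m) = - smul (of_nat (Suc m)) (depth_one k (Suc m))"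
    unfolding smul_of_nat by (rule eq_neg_iff_add_eq_0[THEN iffD2])
  also have "\<dots> = smul (- (of_nat (Suc m) * ((- 1) ^ k * of_nat ((Suc m + k) choose k)))) (depth_one 0 (Suc m + k))"
    unfolding Suc.IH[of "Suc m"] by (simp only: scale_scale scale_minus_left)
  also have "- (of_nat (Suc m) * ((- 1) ^ k * of_nat ((Suc m + k) choose k)))
      = of_nat (Suc k) * ((- 1) ^ Suc k * of_nat ((m + Suc k) choose Suc k) :: rat)"
  proof -
    have "Suc k * ((m + Suc k) choose Suc k) = Suc m * ((Suc m + k) choose k)"
      using Suc_times_binomial_add[of k m] by (simp add: add.commute)
    then have "of_nat (Suc k) * of_nat ((m + Suc k) choose Suc k)
        = (of_nat (Suc m) * of_nat ((Suc m + k) choose k) :: rat)"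
      by (metis of_nat_mult)
    then show ?thesis
      by (simp add: mult.left_commute[of _ "(- 1) ^ k"] del: of_nat_Suc binomial_Suc_Suc)
  qed
  finally have "smul (of_nat (Suc k)) (depth_one (Suc k) m)
      = smul (of_nat (Suc k)) (smul ((- 1) ^ Suc k * of_nat ((m + Suc k) choose Suc k)) (depth_one 0 (m + Suc k)))"
    by (simp del: of_nat_Suc binomial_Suc_Suc power_Suc)
  then show ?case
    by (simp only: scale_left_imp_eq scale_cancel_left of_nat_eq_0_iff nat.distinct simp_thms)
qed simp

lemma coef_zeta_mot_odd:
  assumes "odd r" "3 \<le> r"
  shows "coef [r] 0 (zeta_mot Imot r) = 1"
proof -
  obtain n where "r = 2 * n + 1" "1 \<le> n" using assms by (elim oddE) auto
  then show ?thesis using iso_zeta_odd[of n] by (simp add: f_gen_def)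
qed

lemma coef_depth_one:
  assumes "odd r" "3 \<le> r" "k + m + 1 = r"
  shows "coef [r] 0 (depth_one k m) = - ((- 1) ^ k) * of_nat ((r - 1) choose k)"
proof -
  have mk: "m + k = r - 1" using assms by simp
  have "depth_one 0 (m + k) = - zeta_mot Imot r"
    unfolding mk using zeta_mot_depth_one[of r] assms by simp
  then have "coef [r] 0 (depth_one k m) = - ((- 1) ^ k * of_nat ((m + k) choose k) * coef [r] 0 (zeta_mot Imot r))"
    unfolding depth_one_eq[of k m] by (simp add: iso_scale)
  then show ?thesis
    using coef_zeta_mot_odd[OF assms(1,2)] by (simp add: mk)
qed

lemma zeta_mot_in_gr: "1 \<le> n \<Longrightarrow> zeta_mot Imot n \<in> gr n"
  using Imot_in_gr[of False "True # replicate (n - 1) False" True] subspace_neg[OF subspace_span]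
  unfolding zeta_mot_def gr_span by simp

lemma phi_zeta_mot_two_power: "\<phi> (zeta_mot Imot 2 ^ k) = f2_power k"
proof (induction k)
  case (Suc k)
  then show ?case
    by (intro poly_mapping_eqI) (simp add: iso_mult iso_zeta2 f2_power_def U_mult_def lookup_bilin_ext)
qed (simp add: iso_one f2_power_def)

text \<open>For odd n this is the normalization. For even n all derivatives vanish: the first
  subword has equal endpoints and the others consist of zeros. The remaining multiple of f_2^{n/2}
  is identified by \<open>per\<close>.\<close>

lemma phi_zeta_mot:
  assumes "2 \<le> n"
  shows "\<phi> (zeta_mot Imot n) = f_gen n"
proof (cases "even n")
  case False
  then obtain l where "n = 2 * l + 1" by (elim oddE)
  then show ?thesis using iso_zeta_odd[of l] assms by auto
next
  case True
  let ?l = "n div 2"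
  let ?w = "True # replicate (n - 1) False"
  define q where "q = coef [] ?l (zeta_mot Imot n)"
  have "coef (r # u) k (zeta_mot Imot n) = Poly_Mapping.lookup ((\<lambda>_. 0 :: fpoly) r) (u, k)"
    if r: "odd r" "3 \<le> r" "r + 2 \<le> n" for r u k
  proof -
    have "coef [r] 0 (Imot ((False # ?w @ [True]) ! p) (take r (drop p ?w)) ((False # ?w @ [True]) ! (p + r + 1))) = 0"
      if "p \<le> n - r" for p
    proof (cases p)
      case 0
      then show ?thesis using r by (simp add: Im_equal_endpoints nth_append)
    next
      case (Suc p')
      then have "take r (drop p ?w) = replicate r False" using that r by simp
      then show ?thesis using Imot_zeros[of r] r by simp
    qed
    then have "coef (r # u) k (Imot False ?w True) = 0"
      using r assms by (subst coef_Imot) (auto intro!: sum.neutral)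
    then show ?thesis by (simp add: zeta_mot_def)
  qed
  from phi_eq_derivatives[OF zeta_mot_in_gr this]
  have phi: "\<phi> (zeta_mot Imot n) = rsmult q (f2_power ?l)"
    using True assms by (simp add: q_def f_conc_def bilin_ext_def lin_ext_def)
  then have "zeta_mot Imot n = smul q (zeta_mot Imot 2 ^ ?l)"
    by (intro phi_eqD) (simp add: iso_scale phi_zeta_mot_two_power)
  then have "per (zeta_mot Imot n) = of_rat q * per (zeta_mot Imot 2) ^ ?l"
    by (simp add: per_smul per_power)
  then have q: "zeta_val n = of_rat q * zeta_val 2 ^ ?l"
    using per_zeta assms by simp
  \<comment> \<open>Existence of the rational ratio is the identity just obtained from
    \<open>\<phi>\<close>; uniqueness holds because zeta(2) is nonzero.\<close>
  have "even_zeta_ratio ?l = q"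
    unfolding even_zeta_ratio_def
  proof (rule the_equality)
    show "zeta_val (2 * ?l) = of_rat q * zeta_val 2 ^ ?l" using q True by simp
    show "q' = q" if "zeta_val (2 * ?l) = of_rat q' * zeta_val 2 ^ ?l" for q'
      using q that True zeta_val_pos[of 2] by simp
  qed
  then show ?thesis using phi True by (simp add: f_gen_def)
qed

section \<open>Depth two\<close>

text \<open>In the word with its endpoints the letter 1 stands at the positions 1, a + 1 and N + 1.
  A subword counts only if its endpoints differ and it is not all zeros, which leaves p = 0, p = 1
  and p = N - r.\<close>

lemma coef_dzeta_mot:
  assumes ab: "1 \<le> a" "2 \<le> b" and N: "N = a + b" and r: "odd r" "3 \<le> r" "r + 2 \<le> N"
  shows "coef (r # u) k (dzeta_mot Imot a b)
    = ((if r = a then 1 else 0) + (- 1) ^ a * of_nat ((r - 1) choose (a - 1))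
        - (- 1) ^ b * of_nat ((r - 1) choose (b - 1))) * Poly_Mapping.lookup (f_gen (N - r)) (u, k)"
proof -
  define w where "w = True # replicate (a - 1) False @ True # replicate (b - 1) False"
  define e where "e = False # w @ [True]"
  define L where "L p = coef [r] 0 (Imot (e ! p) (take r (drop p w)) (e ! (p + r + 1)))" for p
  define Rt where "Rt p = coef u k (Imot False (take p w @ drop (p + r) w) True)" for p
  define Z where "Z = Poly_Mapping.lookup (f_gen (N - r)) (u, k)"
  have len: "length w = N" using ab N by (simp add: w_def)
  have w_nth: "w ! i \<longleftrightarrow> i = 0 \<or> i = a" if "i < N" for i
    using that ab N by (auto simp: w_def nth_Cons' nth_append)
  have e_nth: "e ! i \<longleftrightarrow> i = 1 \<or> i = a + 1 \<or> i = N + 1" if "i \<le> N + 1" for i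
    using that w_nth[of "i - 1"] len by (auto simp: e_def nth_Cons' nth_append)
  have Rt: "Rt p = - Z" if "take p w @ drop (p + r) w = True # replicate (N - r - 1) False" for p
  proof -
    have "Imot False (take p w @ drop (p + r) w) True = - zeta_mot Imot (N - r)"
      unfolding that by (simp add: zeta_mot_def)
    then show ?thesis using phi_zeta_mot[of "N - r"] r by (simp add: Rt_def Z_def)
  qed
  have seg_zero: "L p = 0" if "p \<le> N - r" "\<And>i. i < r \<Longrightarrow> p + i \<noteq> 0 \<and> p + i \<noteq> a" for p
  proof -
    have "take r (drop p w) = replicate r False"
      using that r len by (intro nth_equalityI) (auto simp: w_nth)
    then show ?thesis using Imot_zeros[of r] r by (simp add: L_def)
  qed
  have end_zero: "L p = 0" if "p \<le> N - r" "e ! p = e ! (p + r + 1)" for p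
  proof -
    have "take r (drop p w) \<noteq> []" using that r len by auto
    then show ?thesis using that by (simp add: L_def Im_equal_endpoints)
  qed
  define T0 where "T0 = (if r = a then Z else 0)"
  define T1 where "T1 = (- 1) ^ a * of_nat ((r - 1) choose (a - 1)) * Z"
  define T2 where "T2 = - ((- 1) ^ b * of_nat ((r - 1) choose (b - 1)) * Z)"
  \<comment> \<open>The left end is 0, so the right end must be the second 1, which forces r =
    a.\<close>
  have t0: "L 0 * Rt 0 = T0"
  proof (cases "r = a")
    case True
    have "take r (drop 0 w) = replicate 0 False @ True # replicate (r - 1) False"
      using True r N ab by (simp add: w_def take_Cons')
    moreover have "\<not> e ! 0" "e ! (0 + r + 1)"
      using True N by (simp_all add: e_nth)
    ultimately have "L 0 = - 1"
      unfolding L_def using coef_depth_one[of r 0 "r - 1"] r by simp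
    moreover have "Rt 0 = - Z"
      using True r N ab by (intro Rt) (simp add: w_def drop_Cons')
    ultimately show ?thesis using True by (simp add: T0_def)
  next
    case False
    then have "e ! 0 = e ! (0 + r + 1)" using r N by (simp add: e_nth)
    then show ?thesis using end_zero[of 0] False by (simp add: T0_def)
  qed
  \<comment> \<open>The segment starts right after the first 1 and must contain the second. It runs
    from 1 to 0 and is reversed, with sign (-1)^r = -1. For a > r the binomial coefficient vanishes
    as well.\<close>
  have t1: "L 1 * Rt 1 = T1"
  proof (cases "a \<le> r")
    case True
    have "take r (drop 1 w) = replicate (a - 1) False @ True # replicate (r - a) False"
      using True r len N ab by (intro nth_equalityI) (auto simp: w_nth nth_append nth_Cons')
    moreover have "e ! 1" "\<not> e ! (1 + r + 1)"
      using True N r by (simp_all add: e_nth)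
    ultimately have "L 1 = coef [r] 0 (Imot True (replicate (a - 1) False @ True # replicate (r - a) False) False)"
      by (simp add: L_def)
    also have "Imot True (replicate (a - 1) False @ True # replicate (r - a) False) False
        = - depth_one (r - a) (a - 1)"
      using Im_reverse[of "replicate (r - a) False @ True # replicate (a - 1) False"] True r ab by simp
    also have "coef [r] 0 \<dots> = (- 1) ^ (r - a) * of_nat ((r - 1) choose (r - a))"
      using coef_depth_one[of r "r - a" "a - 1"] True r ab by simp
    also have "(r - 1) choose (r - a) = (r - 1) choose (a - 1)"
      using binomial_symmetric[of "a - 1" "r - 1"] True ab by simp
    also have "(- 1 :: rat) ^ (r - a) = - ((- 1) ^ a)"
      using True r by (simp add: minus_one_power_iff)
    finally have "L 1 = - ((- 1) ^ a) * of_nat ((r - 1) choose (a - 1))" .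
    moreover have "Rt 1 = - Z"
      using True r N ab len
      by (intro Rt nth_equalityI) (auto simp: w_nth nth_append nth_Cons')
    ultimately show ?thesis by (simp add: T1_def)
  next
    case False
    have "L 1 = 0"
    proof (cases "r + 1 = a")
      case True
      then show ?thesis using r N by (intro end_zero) (simp_all add: e_nth)
    next
      case not: False
      then show ?thesis using r N False by (intro seg_zero) auto
    qed
    moreover have "(r - 1) choose (a - 1) = 0" using False r by (simp add: binomial_eq_0)
    ultimately show ?thesis by (simp add: T1_def)
  qed
  \<comment> \<open>The segment runs up to the right endpoint 1 and contains the second 1 exactly if
    b \<le> r.\<close>
  have t2: "L (N - r) * Rt (N - r) = T2"
  proof (cases "b \<le> r")
    case True
    have "take r (drop (N - r) w) = replicate (r - b) False @ True # replicate (b - 1) False"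
      using True r len N ab by (intro nth_equalityI) (auto simp: w_nth nth_append nth_Cons')
    moreover have "\<not> e ! (N - r)" "e ! (N - r + r + 1)"
      using True N r ab by (auto simp: e_nth)
    ultimately have "L (N - r) = coef [r] 0 (depth_one (r - b) (b - 1))"
      by (simp add: L_def)
    also have "\<dots> = - ((- 1) ^ (r - b)) * of_nat ((r - 1) choose (r - b))"
      using coef_depth_one[of r "r - b" "b - 1"] True r ab by simp
    also have "(r - 1) choose (r - b) = (r - 1) choose (b - 1)"
      using binomial_symmetric[of "b - 1" "r - 1"] True ab by simp
    also have "(- 1 :: rat) ^ (r - b) = - ((- 1) ^ b)"
      using True r by (simp add: minus_one_power_iff)
    finally have "L (N - r) = (- 1) ^ b * of_nat ((r - 1) choose (b - 1))" by simp
    moreover have "Rt (N - r) = - Z"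
      using True r N ab len
      by (intro Rt nth_equalityI) (auto simp: w_nth nth_append nth_Cons')
    ultimately show ?thesis by (simp add: T2_def)
  next
    case False
    have "L (N - r) = 0"
    proof (cases "r + 1 = b")
      case True
      then show ?thesis using r N by (intro end_zero) (auto simp: e_nth)
    next
      case not: False
      then show ?thesis using r N False by (intro seg_zero) auto
    qed
    moreover have "(r - 1) choose (b - 1) = 0" using False r by (simp add: binomial_eq_0)
    ultimately show ?thesis by (simp add: T2_def)
  qed
  \<comment> \<open>The endpoints can differ only if one of them is the second 1, and then the
    segment consists of zeros.\<close>
  have t_other: "L p * Rt p = 0" if p: "p \<le> N - r" "p \<noteq> 0" "p \<noteq> 1" "p \<noteq> N - r" for p
  proof -
    have "L p = 0"
    proof (cases "p = a + 1 \<or> p + r = a")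
      case True
      then show ?thesis using p by (intro seg_zero) auto
    next
      case False
      then show ?thesis using p r N by (intro end_zero) (auto simp: e_nth)
    qed
    then show ?thesis by simp
  qed
  have "coef (r # u) k (Imot False w True) = (\<Sum>p = 0..N - r. L p * Rt p)"
    unfolding L_def Rt_def e_def using coef_Imot[of r w False True u k] r len by simp
  also have "\<dots> = (\<Sum>p\<in>{0, 1, N - r}. L p * Rt p)"
    using r t_other by (intro sum.mono_neutral_right) auto
  also have "\<dots> = T0 + T1 + T2"
    using r t0 t1 t2 by simp
  finally show ?thesis
    by (simp add: dzeta_mot_def w_def T0_def T1_def T2_def Z_def algebra_simps)
qed

section \<open>The coefficient of \<open>f\<^sub>N\<close> in odd weight\<close>

text \<open>Shuffles are split according to which leading 1 comes first; i zeros before the other 1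
  give zeta(i+1, m+n-i+1). At i = m + n, where the series diverges, both binomial coefficients
  vanish because m and n are positive.\<close>

lemma shuffle_dzeta_val:
  assumes "1 \<le> m" "1 \<le> n"
  shows "zeta_val (m + 1) * zeta_val (n + 1)
    = (\<Sum>i\<le>m + n. (real ((m + n - i) choose m) + real ((m + n - i) choose n)) * dzeta_val (i + 1) (m + n - i + 1))"
proof -
  let ?I = "\<lambda>w. Imot False (True # w) True"
  have summand: "of_nat ((m + n - i) choose l) * ?I (replicate i False @ True # replicate (m + n - i) False)
      = of_nat ((m + n - i) choose l) * dzeta_mot Imot (i + 1) (m + n - i + 1)" for i l
    by (simp add: dzeta_mot_def)
  have per_term: "per (of_nat ((m + n - i) choose l) * dzeta_mot Imot (i + 1) (m + n - i + 1))
      = real ((m + n - i) choose l) * dzeta_val (i + 1) (m + n - i + 1)" if "i + l \<le> m + n" "1 \<le> l" for i l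
    using that by (simp add: per_mult per_of_nat per_dzeta)
  have tail: "(\<Sum>i\<le>m + n - l. real ((m + n - i) choose l) * dzeta_val (i + 1) (m + n - i + 1))
      = (\<Sum>i\<le>m + n. real ((m + n - i) choose l) * dzeta_val (i + 1) (m + n - i + 1))" if "l \<le> m + n" for l
    using that by (intro sum.mono_neutral_left) (auto simp: binomial_eq_0)
  have "zeta_mot Imot (m + 1) * zeta_mot Imot (n + 1) = ?I (replicate m False) * ?I (replicate n False)"
    by (simp add: zeta_mot_def)
  also have "\<dots> = (\<Sum>w\<in>#shuffle_mset (replicate m False) (True # replicate n False). ?I w)
      + (\<Sum>w\<in>#shuffle_mset (replicate n False) (True # replicate m False). ?I w)"
    unfolding Im_shuffle
    by (simp add: shuffle_mset_commute[of "True # replicate m False" "replicate n False"] multiset.map_comp comp_def)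
  also have "\<dots> = (\<Sum>i\<le>m. of_nat ((m + n - i) choose n) * dzeta_mot Imot (i + 1) (m + n - i + 1))
      + (\<Sum>i\<le>n. of_nat ((m + n - i) choose m) * dzeta_mot Imot (i + 1) (m + n - i + 1))"
    unfolding sum_shuffle_replicate_depth_one by (simp only: summand add.commute[of n m])
  finally have "per (zeta_mot Imot (m + 1)) * per (zeta_mot Imot (n + 1))
      = (\<Sum>i\<le>m. per (of_nat ((m + n - i) choose n) * dzeta_mot Imot (i + 1) (m + n - i + 1)))
      + (\<Sum>i\<le>n. per (of_nat ((m + n - i) choose m) * dzeta_mot Imot (i + 1) (m + n - i + 1)))"
    by (simp only: per_mult[symmetric] per_add per_sum)
  also have "(\<Sum>i\<le>m. per (of_nat ((m + n - i) choose n) * dzeta_mot Imot (i + 1) (m + n - i + 1)))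
      = (\<Sum>i\<le>m. real ((m + n - i) choose n) * dzeta_val (i + 1) (m + n - i + 1))"
    using assms by (intro sum.cong per_term) auto
  also have "(\<Sum>i\<le>n. per (of_nat ((m + n - i) choose m) * dzeta_mot Imot (i + 1) (m + n - i + 1)))
      = (\<Sum>i\<le>n. real ((m + n - i) choose m) * dzeta_val (i + 1) (m + n - i + 1))"
    using assms by (intro sum.cong per_term) auto
  also have "(\<Sum>i\<le>m. real ((m + n - i) choose n) * dzeta_val (i + 1) (m + n - i + 1))
      + (\<Sum>i\<le>n. real ((m + n - i) choose m) * dzeta_val (i + 1) (m + n - i + 1))
      = (\<Sum>i\<le>m + n. real ((m + n - i) choose n) * dzeta_val (i + 1) (m + n - i + 1))
      + (\<Sum>i\<le>m + n. real ((m + n - i) choose m) * dzeta_val (i + 1) (m + n - i + 1))"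
    using tail[of n] tail[of m] by simp
  finally show ?thesis
    using assms by (simp add: per_zeta distrib_right sum.distrib add.commute)
qed

text \<open>The divergent value \<open>\<zeta>(N - 1, 1)\<close> is replaced by the number for which both double shuffle
  relations hold with \<open>\<zeta>(1) \<zeta>(N - 1)\<close> read as 0; for the shuffle relation this is the sum
  formula.\<close>

lemma dzeta_val_odd_weight:
  assumes ab: "1 \<le> a" "2 \<le> b" and N: "N = a + b" "odd N"
  shows "dzeta_val a b = (\<Sum>r | 3 \<le> r \<and> r \<le> N - 2 \<and> odd r.
      ((if r = a then 1 else 0) + (- 1) ^ a * (real ((r - 1) choose (a - 1)) + real ((r - 1) choose (b - 1))))
        * (zeta_val r * zeta_val (N - r)))
    - zeta_val N / 2 * (1 + (- 1) ^ a * real (N choose a))"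
proof -
  define d where "d = N - 2"
  \<comment> \<open>The value at i = d is forced by the stuffle relation at i = 0, whose right side
    is \<open>p 0 = 0\<close>.\<close>
  define z where "z i = (if i < d then dzeta_val (i + 1) (d - i + 1) else - zeta_val N - dzeta_val 1 (d + 1))" for i
  define p where "p m = (if m = 0 \<or> m = d then 0 else zeta_val (m + 1) * zeta_val (d - m + 1))" for m
  have d: "odd d" "1 \<le> d" "N = d + 2" using ab N by (auto simp: d_def)
  have z0: "z 0 = dzeta_val 1 (d + 1)" and zd: "z d = - zeta_val N - dzeta_val 1 (d + 1)"
    using d by (auto simp: z_def)
  have stuffle: "z i + z (d - i) + zeta_val N = p i" if "i \<le> d" for i
  proof (cases "i = 0 \<or> i = d")
    case True
    then show ?thesis using z0 zd by (auto simp: p_def)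
  next
    case False
    then have "0 < i" "i < d" using that by auto
    then show ?thesis
      using stuffle_dzeta_val[of "i + 1" "d - i + 1"] by (simp add: z_def p_def d)
  qed
  have shuffle: "p m = (\<Sum>i\<le>d. (real ((d - i) choose m) + real ((d - i) choose (d - m))) * z i)" if "m \<le> d" for m
  proof (cases "m = 0 \<or> m = d")
    case True
    have "(\<Sum>i\<le>d. (real ((d - i) choose m) + real ((d - i) choose (d - m))) * z i)
        = (\<Sum>i\<le>d. z i) + (\<Sum>i\<le>d. real ((d - i) choose d) * z i)"
      using True by (auto simp: sum.distrib[symmetric] algebra_simps)
    also have "(\<Sum>i\<le>d. real ((d - i) choose d) * z i) = (\<Sum>i\<le>d. if i = 0 then z i else 0)"
      by (rule sum.cong) (auto simp: binomial_eq_0)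
    also have "\<dots> = z 0" by simp
    also have "(\<Sum>i\<le>d. z i) = (\<Sum>i<d. dzeta_val (Suc i) (d + 1 - i)) + z d"
      by (simp add: lessThan_Suc_atMost[symmetric] z_def Suc_diff_le)
    also have "\<dots> = zeta_val N + z d"
      using sum_formula_dzeta_val[OF d(2)] d(3) by simp
    finally show ?thesis using True z0 zd by (auto simp: p_def)
  next
    case False
    then have m: "1 \<le> m" "1 \<le> d - m" "m + (d - m) = d" using that by auto
    have "p m = (\<Sum>i\<le>d. (real ((d - i) choose m) + real ((d - i) choose (d - m))) * dzeta_val (i + 1) (d - i + 1))"
      using shuffle_dzeta_val[OF m(1,2)] False m(3) by (simp add: p_def)
    also have "\<dots> = (\<Sum>i\<le>d. (real ((d - i) choose m) + real ((d - i) choose (d - m))) * z i)"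
      using m by (intro sum.cong) (auto simp: z_def binomial_eq_0)
    finally show ?thesis .
  qed
  define i where "i = a - 1"
  have i: "i < d" "d - i + 1 = b" "i + 1 = a" "d - i = b - 1" using ab N by (auto simp: i_def d_def)
  have sgn: "(- 1 :: real) ^ i = - ((- 1) ^ a)"
    using i(3) by (metis add.commute minus_minus mult_minus1 power_Suc plus_1_eq_Suc)
  have "dzeta_val a b = z i" using i by (simp add: z_def)
  also have "\<dots> = (\<Sum>m | m \<le> d \<and> even m. p m *
      ((if m = i then 1 else 0) - (- 1) ^ i * (real (m choose i) + real (m choose (d - i)))))
      - zeta_val N / 2 * (1 - (- 1) ^ i * real ((d + 2) choose (i + 1)))"
    by (rule odd_double_shuffle_coeff[OF d(1) stuffle shuffle]) (use i in auto)
  also have "(\<Sum>m | m \<le> d \<and> even m. p m *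
      ((if m = i then 1 else 0) - (- 1) ^ i * (real (m choose i) + real (m choose (d - i)))))
      = (\<Sum>m | m \<le> d \<and> even m \<and> m \<noteq> 0. p m *
      ((if m = i then 1 else 0) - (- 1) ^ i * (real (m choose i) + real (m choose (d - i)))))"
    by (rule sum.mono_neutral_right) (auto simp: p_def)
  also have "\<dots> = (\<Sum>r | 3 \<le> r \<and> r \<le> N - 2 \<and> odd r.
      ((if r = a then 1 else 0) + (- 1) ^ a * (real ((r - 1) choose (a - 1)) + real ((r - 1) choose (b - 1))))
        * (zeta_val r * zeta_val (N - r)))"
  \<comment> \<open>The substitution is r = m + 1; m = d does not occur because \<open>d\<close> is
    odd.\<close>
  proof (rule sum.reindex_bij_witness[of _ "\<lambda>r. r - 1" "\<lambda>m. m + 1"])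
    fix m assume "m \<in> {m. m \<le> d \<and> even m \<and> m \<noteq> 0}"
    then have m: "m \<le> d" "even m" "m \<noteq> 0" "m \<noteq> d" using d by auto
    then have "2 \<le> m" by (auto elim!: evenE)
    with m show "m + 1 \<in> {r. 3 \<le> r \<and> r \<le> N - 2 \<and> odd r}" by (auto simp: d_def)
    have "N - (m + 1) = d - m + 1" using m d by simp
    then show "((if m + 1 = a then 1 else 0) + (- 1) ^ a * (real ((m + 1 - 1) choose (a - 1)) + real ((m + 1 - 1) choose (b - 1))))
        * (zeta_val (m + 1) * zeta_val (N - (m + 1)))
      = p m * ((if m = i then 1 else 0) - (- 1) ^ i * (real (m choose i) + real (m choose (d - i))))"
      using m i by (simp add: p_def sgn i_def[symmetric]) auto
  qed (auto simp: d_def)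
  finally show ?thesis
    by (simp only: sgn i(3) d(3)[symmetric] mult_minus_left diff_minus_eq_add)
qed

lemma phi_dzeta_mot:
  assumes ab: "1 \<le> a" "2 \<le> b" and N: "N = a + b"
  defines "q \<equiv> (if even N then coef [] (N div 2) (dzeta_mot Imot a b) else coef [N] 0 (dzeta_mot Imot a b))"
  shows "\<phi> (dzeta_mot Imot a b) = (\<Sum>r | 3 \<le> r \<and> r \<le> N - 2 \<and> odd r.
      rsmult ((if r = a then 1 else 0) + (- 1) ^ a * of_nat ((r - 1) choose (a - 1))
        - (- 1) ^ b * of_nat ((r - 1) choose (b - 1))) (f_conc (f_gen r) (f_gen (N - r))))
    + rsmult q (if even N then f2_power (N div 2) else f_gen N)"
proof -
  have "length (True # replicate (a - 1) False @ True # replicate (b - 1) False) = N"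
    using ab N by simp
  then have gr: "dzeta_mot Imot a b \<in> gr N"
    unfolding dzeta_mot_def by (metis Imot_in_gr)
  have "coef (r # u) k (dzeta_mot Imot a b) = Poly_Mapping.lookup (rsmult
      ((if r = a then 1 else 0) + (- 1) ^ a * of_nat ((r - 1) choose (a - 1))
        - (- 1) ^ b * of_nat ((r - 1) choose (b - 1))) (f_gen (N - r))) (u, k)"
    if "odd r" "3 \<le> r" "r + 2 \<le> N" for r u k
    using coef_dzeta_mot[OF ab N that] by simp
  from phi_eq_derivatives[OF gr this]
  show ?thesis by (cases "even N") (simp_all add: f_conc_rsmult q_def)
qed

text \<open>The formula for \<open>\<phi>\<close> is pulled back to \<open>'h\<close> by injectivity
  and then compared with Euler's evaluation under \<open>per\<close>.\<close>

lemma coef_dzeta_mot_odd_weight: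
  assumes ab: "1 \<le> a" "2 \<le> b" and N: "N = a + b" "odd N"
  shows "coef [N] 0 (dzeta_mot Imot a b) = - (1 + (- 1) ^ a * of_nat (N choose a)) / 2"
proof -
  let ?R = "{r. 3 \<le> r \<and> r \<le> N - 2 \<and> odd r}"
  define c :: "nat \<Rightarrow> rat" where "c r = (if r = a then 1 else 0) + (- 1) ^ a * of_nat ((r - 1) choose (a - 1))
        - (- 1) ^ b * of_nat ((r - 1) choose (b - 1))" for r
  define q where "q = coef [N] 0 (dzeta_mot Imot a b)"
  have sgn: "(- 1 :: 'b::ring_1) ^ b = - ((- 1) ^ a)"
    using N by (auto simp: minus_one_power_iff)
  have "\<phi> (dzeta_mot Imot a b) = (\<Sum>r\<in>?R. rsmult (c r) (f_conc (f_gen r) (f_gen (N - r)))) + rsmult q (f_gen N)"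
    using phi_dzeta_mot[OF ab N(1)] N(2) by (simp add: c_def q_def)
  \<comment> \<open>As N - r is even and at least 2, concatenation agrees with the product and
    \<open>phi_zeta_mot\<close> applies to both factors.\<close>
  also have "\<dots> = (\<Sum>r\<in>?R. rsmult (c r) (\<phi> (zeta_mot Imot r * zeta_mot Imot (N - r)))) + rsmult q (\<phi> (zeta_mot Imot N))"
    using N ab by (intro arg_cong2[of _ _ _ _ "(+)"] sum.cong)
      (auto simp: iso_mult phi_zeta_mot U_mult_f_gen)
  also have "\<dots> = \<phi> ((\<Sum>r\<in>?R. smul (c r) (zeta_mot Imot r * zeta_mot Imot (N - r))) + smul q (zeta_mot Imot N))"
    by (simp add: iso_add phi_sum iso_scale)
  finally have "per (dzeta_mot Imot a b)
      = per ((\<Sum>r\<in>?R. smul (c r) (zeta_mot Imot r * zeta_mot Imot (N - r))) + smul q (zeta_mot Imot N))"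
    by (rule phi_eqD[THEN arg_cong])
  then have "dzeta_val a b = (\<Sum>r\<in>?R. of_rat (c r) * (per (zeta_mot Imot r) * per (zeta_mot Imot (N - r))))
      + of_rat q * zeta_val N"
    using ab N by (simp add: per_add per_sum per_smul per_mult per_zeta per_dzeta)
  also have "(\<Sum>r\<in>?R. of_rat (c r) * (per (zeta_mot Imot r) * per (zeta_mot Imot (N - r))))
      = (\<Sum>r\<in>?R. of_rat (c r) * (zeta_val r * zeta_val (N - r)))"
    by (rule sum.cong) (auto simp: per_zeta)
  \<comment> \<open>Odd N gives (-1)^b = -(-1)^a, so these coefficients are exactly those of Euler's
    evaluation.\<close>
  also have "(\<Sum>r\<in>?R. of_rat (c r) * (zeta_val r * zeta_val (N - r))) = (\<Sum>r\<in>?R.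
      ((if r = a then 1 else 0) + (- 1) ^ a * (real ((r - 1) choose (a - 1)) + real ((r - 1) choose (b - 1))))
        * (zeta_val r * zeta_val (N - r)))"
    by (rule sum.cong) (auto simp: c_def sgn of_rat_add of_rat_mult of_rat_power of_rat_minus distrib_left)
  finally have "of_rat q * zeta_val N = - (zeta_val N / 2 * (1 + (- 1) ^ a * real (N choose a)))"
    using dzeta_val_odd_weight[OF ab N] by simp
  then have "of_rat q * zeta_val N = (- (1 + (- 1) ^ a * real (N choose a)) / 2) * zeta_val N"
    by (simp add: mult.commute del: minus_add_distrib)
  then have "of_rat q = - (1 + (- 1) ^ a * real (N choose a)) / 2"
    using zeta_val_pos[of N] ab N by (subst (asm) mult_right_cancel) auto
  also have "\<dots> = of_rat (- (1 + (- 1) ^ a * of_nat (N choose a)) / 2)"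
    by (simp add: of_rat_add of_rat_diff of_rat_mult of_rat_power of_rat_minus of_rat_divide)
  finally show ?thesis
    by (simp only: of_rat_eq_iff q_def)
qed

end

theorem theorem7p3:
  fixes smul :: "rat \<Rightarrow> 'h::comm_ring_1 \<Rightarrow> 'h"
    and gr :: "nat \<Rightarrow> 'h set"
    and Imot :: "bool \<Rightarrow> bool list \<Rightarrow> bool \<Rightarrow> 'h"
    and per :: "'h \<Rightarrow> real"
    and coact :: "'h \<Rightarrow> ('h \<times> 'h \<Rightarrow>\<^sub>0 rat)"
    and \<phi> :: "'h \<Rightarrow> fpoly"
    and a b N :: nat
  assumes "motivic_mzv smul gr Imot per coact"
    and "normalized_iso smul gr Imot coact \<phi>"
    and "1 \<le> a" and "2 \<le> b" and "N = a + b"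
  shows
    "(odd a \<and> odd b \<longrightarrow>
       (\<exists>q. \<phi> (dzeta_mot Imot a b) =
          (\<Sum>r | 3 \<le> r \<and> r \<le> N - 2 \<and> odd r.
             rsmult (of_nat ((r - 1) choose (b - 1)) - of_nat ((r - 1) choose (a - 1)))
               (f_conc (f_gen r) (f_gen (N - r))))
          + (if 3 \<le> a then f_conc (f_gen a) (f_gen b) else 0)
          + rsmult q (f2_power (N div 2))))
   \<and> (even a \<and> even b \<longrightarrow>
       (\<exists>q. \<phi> (dzeta_mot Imot a b) =
          (\<Sum>r | 3 \<le> r \<and> r \<le> N - 2 \<and> odd r.
             rsmult (of_nat ((r - 1) choose (a - 1)) - of_nat ((r - 1) choose (b - 1)))
               (f_conc (f_gen r) (f_gen (N - r))))
          + rsmult q (f2_power (N div 2))))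
   \<and> (even a \<and> odd b \<longrightarrow>
       \<phi> (dzeta_mot Imot a b) =
          (\<Sum>r | 3 \<le> r \<and> r \<le> N - 2 \<and> odd r.
             rsmult (of_nat ((r - 1) choose (b - 1)) + of_nat ((r - 1) choose (a - 1)))
               (f_conc (f_gen r) (f_gen (N - r))))
          - rsmult (1 / 2 * (of_nat (N choose a) + 1)) (f_gen N))
   \<and> (odd a \<and> even b \<longrightarrow>
       \<phi> (dzeta_mot Imot a b) =
          - (\<Sum>r | 3 \<le> r \<and> r \<le> N - 2 \<and> odd r.
             rsmult (of_nat ((r - 1) choose (b - 1)) + of_nat ((r - 1) choose (a - 1)))
               (f_conc (f_gen r) (f_gen (N - r))))
          + (if 3 \<le> a then f_conc (f_gen a) (f_gen b) else 0)
          + rsmult (1 / 2 * (of_nat (N choose a) - 1)) (f_gen N))"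
proof -
  interpret motivic_mzv smul gr Imot per coact by fact
  interpret normalized_iso smul gr Imot coact \<phi> by fact
  interpret mzv_f_alphabet smul gr Imot per coact \<phi> by unfold_locales
  note ab = \<open>1 \<le> a\<close> \<open>2 \<le> b\<close> and N = \<open>N = a + b\<close>
  let ?R = "{r. 3 \<le> r \<and> r \<le> N - 2 \<and> odd r}"
  define q where "q = (if even N then coef [] (N div 2) (dzeta_mot Imot a b) else coef [N] 0 (dzeta_mot Imot a b))"
  have main: "\<phi> (dzeta_mot Imot a b) = (\<Sum>r\<in>?R. rsmult (c r) (f_conc (f_gen r) (f_gen (N - r))))
      + (if odd a \<and> 3 \<le> a then f_conc (f_gen a) (f_gen b) else 0)
      + rsmult q (if even N then f2_power (N div 2) else f_gen N)"
    if c: "\<And>r. r \<in> ?R \<Longrightarrow> c r = (- 1) ^ a * of_nat ((r - 1) choose (a - 1)) - (- 1) ^ b * of_nat ((r - 1) choose (b - 1))"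
    for c
  proof -
    let ?t = "\<lambda>r. f_conc (f_gen r) (f_gen (N - r))"
    have "(\<Sum>r\<in>?R. rsmult ((if r = a then 1 else 0) + (- 1) ^ a * of_nat ((r - 1) choose (a - 1))
        - (- 1) ^ b * of_nat ((r - 1) choose (b - 1))) (?t r))
      = (\<Sum>r\<in>?R. rsmult (c r) (?t r) + (if r = a then ?t r else 0))"
    proof (rule sum.cong)
      fix r assume "r \<in> ?R"
      show "rsmult ((if r = a then 1 else 0) + (- 1) ^ a * of_nat ((r - 1) choose (a - 1))
          - (- 1) ^ b * of_nat ((r - 1) choose (b - 1))) (?t r) = rsmult (c r) (?t r) + (if r = a then ?t r else 0)"
        unfolding c[OF \<open>r \<in> ?R\<close>] by (auto intro!: poly_mapping_eqI simp: lookup_add algebra_simps)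
    qed simp
    \<comment> \<open>Since b \<ge> 2 gives a \<le> N - 2, the index a lies in \<open>?R\<close>
      exactly if it is odd and at least 3; then N - a = b.\<close>
    also have "\<dots> = (\<Sum>r\<in>?R. rsmult (c r) (?t r)) + (if odd a \<and> 3 \<le> a then f_conc (f_gen a) (f_gen b) else 0)"
      using ab N by (auto simp: sum.distrib)
    finally show ?thesis
      unfolding q_def by (rule trans[OF phi_dzeta_mot[OF ab N] arg_cong2[where f = "(+)"], OF _ refl])
  qed
  show ?thesis
  proof (intro conjI impI)
    assume "odd a \<and> odd b"
    then show "\<exists>q. \<phi> (dzeta_mot Imot a b) =
          (\<Sum>r | 3 \<le> r \<and> r \<le> N - 2 \<and> odd r.
             rsmult (of_nat ((r - 1) choose (b - 1)) - of_nat ((r - 1) choose (a - 1)))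
               (f_conc (f_gen r) (f_gen (N - r))))
          + (if 3 \<le> a then f_conc (f_gen a) (f_gen b) else 0)
          + rsmult q (f2_power (N div 2))"
      using N main[of "\<lambda>r. of_nat ((r - 1) choose (b - 1)) - of_nat ((r - 1) choose (a - 1))"]
      by (intro exI[of _ q]) simp
  next
    assume "even a \<and> even b"
    then show "\<exists>q. \<phi> (dzeta_mot Imot a b) =
          (\<Sum>r | 3 \<le> r \<and> r \<le> N - 2 \<and> odd r.
             rsmult (of_nat ((r - 1) choose (a - 1)) - of_nat ((r - 1) choose (b - 1)))
               (f_conc (f_gen r) (f_gen (N - r))))
          + rsmult q (f2_power (N div 2))"
      using N main[of "\<lambda>r. of_nat ((r - 1) choose (a - 1)) - of_nat ((r - 1) choose (b - 1))"]
      by (intro exI[of _ q]) simp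
  next
    assume par: "even a \<and> odd b"
    have "q = - (1 / 2 * (of_nat (N choose a) + 1))"
      using coef_dzeta_mot_odd_weight[OF ab N] par N by (simp add: q_def field_simps)
    then show "\<phi> (dzeta_mot Imot a b) =
          (\<Sum>r | 3 \<le> r \<and> r \<le> N - 2 \<and> odd r.
             rsmult (of_nat ((r - 1) choose (b - 1)) + of_nat ((r - 1) choose (a - 1)))
               (f_conc (f_gen r) (f_gen (N - r))))
          - rsmult (1 / 2 * (of_nat (N choose a) + 1)) (f_gen N)"
      using par N main[of "\<lambda>r. of_nat ((r - 1) choose (b - 1)) + of_nat ((r - 1) choose (a - 1))"]
      by (simp add: free.scale_minus_left add.commute)
  next
    assume par: "odd a \<and> even b"
    have q: "q = 1 / 2 * (of_nat (N choose a) - 1)"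
      using coef_dzeta_mot_odd_weight[OF ab N] par N by (simp add: q_def)
    have "\<phi> (dzeta_mot Imot a b) = (\<Sum>r\<in>?R. rsmult (- (of_nat ((r - 1) choose (b - 1)) + of_nat ((r - 1) choose (a - 1))))
               (f_conc (f_gen r) (f_gen (N - r))))
          + (if 3 \<le> a then f_conc (f_gen a) (f_gen b) else 0) + rsmult q (f_gen N)"
      using par N main[of "\<lambda>r. - (of_nat ((r - 1) choose (b - 1)) + of_nat ((r - 1) choose (a - 1)))"]
      by simp
    then show "\<phi> (dzeta_mot Imot a b) =
          - (\<Sum>r | 3 \<le> r \<and> r \<le> N - 2 \<and> odd r.
             rsmult (of_nat ((r - 1) choose (b - 1)) + of_nat ((r - 1) choose (a - 1)))
               (f_conc (f_gen r) (f_gen (N - r))))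
          + (if 3 \<le> a then f_conc (f_gen a) (f_gen b) else 0)
          + rsmult (1 / 2 * (of_nat (N choose a) - 1)) (f_gen N)"
      by (simp only: q free.scale_minus_left sum_negf)
  qed
qed

end
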